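(* For every $C>0$ there is $h_0=h_0(C)\in\mathbb{R}$ such that for all $h<h_0$ the manifold $\Sigma_{C,h}$ is a hypersurface of contact type in the symplectic manifold $\left((0,\pi)\times\mathbb{R}\times S^2_C,\ \omega\right)$.
   Context: Let $S^2_C=\{(m_1,m_2,m_3)\in\mathbb{R}^3: m_1^2+m_2^2+m_3^2=C\}$ with inclusion $i:S^2_C\hookrightarrow\mathbb{R}^3$. On $(0,\pi)\times\mathbb{R}\times S^2_C$ with coordinates $(q,p,m_1,m_2,m_3)$, consider the symplectic form $$\omega=\mathrm{d}p\wedge\mathrm{d}q+i^*\left(m_1\,\mathrm{d}m_2\wedge\mathrm{d}m_3+m_2\,\mathrm{d}m_3\wedge\mathrm{d}m_1+m_3\,\mathrm{d}m_1\wedge\mathrm{d}m_2\right).$$ In the coordinates $m_1=\sqrt C\cos\theta\cos\phi$, $m_2=\sqrt C\cos\theta\sin\phi$, $m_3=\sqrt C\sin\theta$ this is $\omega=\mathrm{d}p\wedge\mathrm{d}q+C^{3/2}\cos\theta\,\mathrm{d}\phi\wedge\mathrm{d}\theta$. With $\xi=\cot q$, let $$\mathcal{H}=\tfrac12\left(m_1^2+m_2^2-2m_1p+2p^2+\xi(-2-2m_2m_3+m_3^2\xi)+m_3^2(1+\xi^2)\right)$$ (the reduced Hamiltonian of the equal-mass two-body problem on $S^2$ with cotangent potential), and let $\Sigma_{C,h}=\{\mathcal{H}=h\}\subset(0,\pi)\times\mathbb{R}\times S^2_C$. A smooth hypersurface $X$ of a symplectic manifold $(M,\omega)$ is of contact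 type if there is a 1-form $\alpha$ on $X$ such that $\mathrm{d}\alpha=\omega|_X$ and $\alpha(v)\neq0$ for every non-zero $v\in\mathcal{L}_X$, where $\mathcal{L}_X\subset TX$ is the characteristic line bundle, spanned by the kernel of $\omega|_X$. *)

theory Defs
  imports "HOL-Analysis.Analysis"
begin

section \<open>Smooth maps and submanifolds of a Euclidean space\<close>

text \<open>
  Only used on open sets. In finite dimension, being differentiable with all directional
  derivatives \<open>n\<close> times continuously differentiable is the usual notion of class
  \<open>C\<^sup>n\<^sup>+\<^sup>1\<close>.
\<close>

primrec Ck_on :: "nat \<Rightarrow> 'a set \<Rightarrow> ('a::euclidean_space \<Rightarrow> 'b::euclidean_space) \<Rightarrow> bool" where
  "Ck_on 0 S f \<longleftrightarrow> continuous_on S f"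
| "Ck_on (Suc n) S f \<longleftrightarrow>
     (\<forall>x\<in>S. f differentiable (at x)) \<and>
     (\<forall>v. Ck_on n S (\<lambda>x. frechet_derivative f (at x) v))"

definition smooth_on :: "'a set \<Rightarrow> ('a::euclidean_space \<Rightarrow> 'b::euclidean_space) \<Rightarrow> bool" where
  "smooth_on S f \<longleftrightarrow> (\<forall>n. Ck_on n S f)"

text \<open>Embedded \<open>k\<close>-dimensional submanifolds, by slice charts.\<close>

definition smooth_submanifold :: "nat \<Rightarrow> 'a::euclidean_space set \<Rightarrow> bool" where
  "smooth_submanifold k X \<longleftrightarrow>
     (\<forall>x\<in>X. \<exists>(U::'a set) (V::'a set) \<phi> \<psi> L.
        open U \<and> x \<in> U \<and> open V \<and> homeomorphism U V \<phi> \<psi> \<and>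
        smooth_on U \<phi> \<and> smooth_on V \<psi> \<and>
        subspace L \<and> dim L = k \<and> \<phi> ` (U \<inter> X) = V \<inter> L)"

definition tangent_space :: "'a::euclidean_space set \<Rightarrow> 'a \<Rightarrow> 'a set" where
  "tangent_space X x =
     {v. \<exists>\<epsilon>>0. \<exists>\<gamma>::real \<Rightarrow> 'a.
        smooth_on {-\<epsilon><..<\<epsilon>} \<gamma> \<and> \<gamma> ` {-\<epsilon><..<\<epsilon>} \<subseteq> X \<and>
        \<gamma> 0 = x \<and> (\<gamma> has_vector_derivative v) (at 0)}"

section \<open>Differential forms\<close>

subsection \<open>Forms on open sets\<close>

definition open_form1 :: "'a::euclidean_space set \<Rightarrow> ('a \<Rightarrow> 'a \<Rightarrow> real) \<Rightarrow> bool" where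
  "open_form1 U \<beta> \<longleftrightarrow>
     open U \<and> (\<forall>x\<in>U. linear (\<beta> x)) \<and> (\<forall>v. smooth_on U (\<lambda>x. \<beta> x v))"

definition open_form2 :: "'a::euclidean_space set \<Rightarrow> ('a \<Rightarrow> 'a \<Rightarrow> 'a \<Rightarrow> real) \<Rightarrow> bool" where
  "open_form2 U \<sigma> \<longleftrightarrow>
     open U \<and> (\<forall>x\<in>U. bilinear (\<sigma> x) \<and> (\<forall>v. \<sigma> x v v = 0)) \<and>
     (\<forall>u v. smooth_on U (\<lambda>x. \<sigma> x u v))"

text \<open>
  Exterior derivatives evaluated on constant vector fields, normalised without factorials, so
  that \<open>d(f dg)(u,v) = (df \<and> dg)(u,v) = df(u) dg(v) - df(v) dg(u)\<close>.
\<close>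

definition ext_deriv1 ::
    "('a::euclidean_space \<Rightarrow> 'a \<Rightarrow> real) \<Rightarrow> 'a \<Rightarrow> 'a \<Rightarrow> 'a \<Rightarrow> real" where
  "ext_deriv1 \<beta> x u v =
     frechet_derivative (\<lambda>y. \<beta> y v) (at x) u - frechet_derivative (\<lambda>y. \<beta> y u) (at x) v"

definition ext_deriv2 ::
    "('a::euclidean_space \<Rightarrow> 'a \<Rightarrow> 'a \<Rightarrow> real) \<Rightarrow> 'a \<Rightarrow> 'a \<Rightarrow> 'a \<Rightarrow> 'a \<Rightarrow> real" where
  "ext_deriv2 \<sigma> x u v w =
     frechet_derivative (\<lambda>y. \<sigma> y v w) (at x) u
     - frechet_derivative (\<lambda>y. \<sigma> y u w) (at x) v
     + frechet_derivative (\<lambda>y. \<sigma> y u v) (at x) w"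

subsection \<open>Forms on submanifolds\<close>

text \<open>
  A form on a submanifold \<open>X\<close> assigns to each \<open>x \<in> X\<close> an alternating form on the tangent space
  of \<open>X\<close> at \<open>x\<close>; its values elsewhere are irrelevant. It is smooth iff it is locally the
  restriction (pullback along the inclusion) of a smooth form on an open subset of the ambient
  space. Since exterior differentiation commutes with pullback, its exterior derivative is
  the restriction of the exterior derivative of any such local extension.
\<close>

definition extends1 ::
    "'a::euclidean_space set \<Rightarrow> ('a \<Rightarrow> 'a \<Rightarrow> real) \<Rightarrow> 'a set \<Rightarrow> ('a \<Rightarrow> 'a \<Rightarrow> real) \<Rightarrow> bool" where
  "extends1 X \<alpha> U \<beta> \<longleftrightarrow>
     open_form1 U \<beta> \<and> (\<forall>y\<in>U \<inter> X. \<forall>v\<in>tangent_space X y. \<alpha> y v = \<beta> y v)"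

definition extends2 ::
    "'a::euclidean_space set \<Rightarrow> ('a \<Rightarrow> 'a \<Rightarrow> 'a \<Rightarrow> real) \<Rightarrow> 'a set \<Rightarrow>
     ('a \<Rightarrow> 'a \<Rightarrow> 'a \<Rightarrow> real) \<Rightarrow> bool" where
  "extends2 X \<eta> U \<sigma> \<longleftrightarrow>
     open_form2 U \<sigma> \<and>
     (\<forall>y\<in>U \<inter> X. \<forall>u\<in>tangent_space X y. \<forall>v\<in>tangent_space X y. \<eta> y u v = \<sigma> y u v)"

definition form1_on :: "'a::euclidean_space set \<Rightarrow> ('a \<Rightarrow> 'a \<Rightarrow> real) \<Rightarrow> bool" where
  "form1_on X \<alpha> \<longleftrightarrow> (\<forall>x\<in>X. \<exists>U \<beta>. x \<in> U \<and> extends1 X \<alpha> U \<beta>)"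

definition form2_on :: "'a::euclidean_space set \<Rightarrow> ('a \<Rightarrow> 'a \<Rightarrow> 'a \<Rightarrow> real) \<Rightarrow> bool" where
  "form2_on X \<eta> \<longleftrightarrow> (\<forall>x\<in>X. \<exists>U \<sigma>. x \<in> U \<and> extends2 X \<eta> U \<sigma>)"

text \<open>\<open>d\<alpha> = \<eta>\<close> as 2-forms on \<open>X\<close>.\<close>

definition has_ext_deriv1 ::
    "'a::euclidean_space set \<Rightarrow> ('a \<Rightarrow> 'a \<Rightarrow> real) \<Rightarrow> ('a \<Rightarrow> 'a \<Rightarrow> 'a \<Rightarrow> real) \<Rightarrow> bool" where
  "has_ext_deriv1 X \<alpha> \<eta> \<longleftrightarrow>
     (\<forall>x\<in>X. \<exists>U \<beta>. x \<in> U \<and> extends1 X \<alpha> U \<beta> \<and>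
        (\<forall>u\<in>tangent_space X x. \<forall>v\<in>tangent_space X x. ext_deriv1 \<beta> x u v = \<eta> x u v))"

definition closed_form2_on :: "'a::euclidean_space set \<Rightarrow> ('a \<Rightarrow> 'a \<Rightarrow> 'a \<Rightarrow> real) \<Rightarrow> bool" where
  "closed_form2_on X \<eta> \<longleftrightarrow>
     (\<forall>x\<in>X. \<exists>U \<sigma>. x \<in> U \<and> extends2 X \<eta> U \<sigma> \<and>
        (\<forall>u\<in>tangent_space X x. \<forall>v\<in>tangent_space X x. \<forall>w\<in>tangent_space X x.
           ext_deriv2 \<sigma> x u v w = 0))"

section \<open>Hypersurfaces of contact type\<close>

definition form_kernel ::
    "'a::euclidean_space set \<Rightarrow> ('a \<Rightarrow> 'a \<Rightarrow> 'a \<Rightarrow> real) \<Rightarrow> 'a \<Rightarrow> 'a set" where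
  "form_kernel X \<eta> x = {v \<in> tangent_space X x. \<forall>w\<in>tangent_space X x. \<eta> x v w = 0}"

definition symplectic_manifold ::
    "nat \<Rightarrow> 'a::euclidean_space set \<Rightarrow> ('a \<Rightarrow> 'a \<Rightarrow> 'a \<Rightarrow> real) \<Rightarrow> bool" where
  "symplectic_manifold n M \<omega> \<longleftrightarrow>
     smooth_submanifold n M \<and> form2_on M \<omega> \<and> closed_form2_on M \<omega> \<and>
     (\<forall>x\<in>M. form_kernel M \<omega> x = {0})"

text \<open>
  A smooth hypersurface of \<open>M\<close> is an embedded submanifold contained in \<open>M\<close>, of codimension one.
  The restriction of \<open>\<omega>\<close> to \<open>X\<close> is \<open>\<omega>\<close> itself, evaluated on vectors tangent to \<open>X\<close> only;
  the fibre at \<open>x\<close> of the characteristic line bundle is its kernel \<open>form_kernel X \<omega> x\<close>.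
\<close>

definition contact_type_hypersurface ::
    "'a::euclidean_space set \<Rightarrow> ('a \<Rightarrow> 'a \<Rightarrow> 'a \<Rightarrow> real) \<Rightarrow> 'a set \<Rightarrow> bool" where
  "contact_type_hypersurface M \<omega> X \<longleftrightarrow>
     (\<exists>n. symplectic_manifold (Suc n) M \<omega> \<and> smooth_submanifold n X) \<and> X \<subseteq> M \<and>
     (\<exists>\<alpha>. form1_on X \<alpha> \<and> has_ext_deriv1 X \<alpha> \<omega> \<and>
        (\<forall>x\<in>X. \<forall>v\<in>form_kernel X \<omega> x. v \<noteq> 0 \<longrightarrow> \<alpha> x v \<noteq> 0))"

section \<open>The reduced two-body problem on the sphere\<close>

text \<open>Points and tangent vectors are triples \<open>(q, p, m)\<close> with \<open>m = (m\<^sub>1, m\<^sub>2, m\<^sub>3)\<close>.\<close>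

type_synonym phase = "real \<times> real \<times> (real^3)"

definition phase_space :: "real \<Rightarrow> phase set" where
  "phase_space C =
     {(q, p, m). 0 < q \<and> q < pi \<and> (m$1)\<^sup>2 + (m$2)\<^sup>2 + (m$3)\<^sup>2 = C}"

text \<open>
  \<open>\<omega> = dp \<and> dq + m\<^sub>1 dm\<^sub>2 \<and> dm\<^sub>3 + m\<^sub>2 dm\<^sub>3 \<and> dm\<^sub>1 + m\<^sub>3 dm\<^sub>1 \<and> dm\<^sub>2\<close> as a 2-form on the ambient
  space; pulling it back to the phase space is restricting it to tangent vectors.
\<close>

definition omega :: "phase \<Rightarrow> phase \<Rightarrow> phase \<Rightarrow> real" where
  "omega = (\<lambda>(q, p, m) (a, b, u) (a', b', u').
     (b * a' - b' * a)
     + m$1 * (u$2 * u'$3 - u'$2 * u$3)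
     + m$2 * (u$3 * u'$1 - u'$3 * u$1)
     + m$3 * (u$1 * u'$2 - u'$1 * u$2))"

definition hamiltonian :: "phase \<Rightarrow> real" where
  "hamiltonian = (\<lambda>(q, p, m). let \<xi> = cot q in
     1/2 * ((m$1)\<^sup>2 + (m$2)\<^sup>2 - 2 * m$1 * p + 2 * p\<^sup>2
            + \<xi> * (- 2 - 2 * m$2 * m$3 + (m$3)\<^sup>2 * \<xi>) + (m$3)\<^sup>2 * (1 + \<xi>\<^sup>2)))"

definition energy_level :: "real \<Rightarrow> real \<Rightarrow> phase set" where
  "energy_level C h = {x \<in> phase_space C. hamiltonian x = h}"

end

theory Submission
  imports Defs
begin

text \<open>
  For very negative energies a motion stays near collision: \<open>\<xi>\<close> is large and \<open>m\<^sub>3\<close> is small, so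
  \<open>\<Sigma>\<^sub>C\<^sub>,\<^sub>h\<close> avoids the poles of the sphere, where the form
  \<open>\<alpha> = -q dp + C m\<^sub>3 (m\<^sub>2 dm\<^sub>1 - m\<^sub>1 dm\<^sub>2) / (m\<^sub>1\<^sup>2 + m\<^sub>2\<^sup>2) = -q dp - C m\<^sub>3 d\<phi>\<close> is singular. Here
  \<open>\<alpha> = \<omega>(Y, \<cdot>)\<close> and \<open>d\<alpha> = \<omega>\<close> for the field \<open>Y = q \<partial>\<^sub>q + m\<^sub>3 \<partial>\<^sub>m\<^sub>3\<close> (with \<open>\<phi>\<close> fixed). The large terms
  \<open>2 \<xi>\<^sup>2 m\<^sub>3\<^sup>2\<close> cancel in \<open>dH(Y)\<close>, leaving \<open>\<xi>\<close> plus terms of lower order, which is positive.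
  So \<open>\<Sigma>\<^sub>C\<^sub>,\<^sub>h\<close> is a regular level set transverse to \<open>Y\<close>, and a vector of its characteristic line on
  which \<open>\<alpha>\<close> vanishes is \<open>\<omega>\<close>-orthogonal to everything, hence zero.
\<close>

section \<open>Calculus of smooth maps\<close>

text \<open>At a point of the open set \<open>S\<close> the derivative depends only on values taken
  in \<open>S\<close>, so agreement on \<open>S\<close> passes to \<open>frechet_derivative\<close>
  and, inductively, to all higher orders.\<close>

lemma Ck_on_cong:
  assumes "open S" "\<And>x. x \<in> S \<Longrightarrow> f x = g x" "Ck_on n S f"
  shows "Ck_on n S g"
  using assms(2,3)
proof (induction n arbitrary: f g)
  case 0
  then show ?case by (simp cong: continuous_on_cong)
next
  case (Suc n)
  have D: "(g has_derivative frechet_derivative f (at x)) (at x)" if "x \<in> S" for x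
    using has_derivative_transform_within_open[OF _ \<open>open S\<close> that, of f _ UNIV g] Suc.prems that
    by (simp add: frechet_derivative_works)
  then have eq: "frechet_derivative f (at x) = frechet_derivative g (at x)" if "x \<in> S" for x
    using frechet_derivative_at that by blast
  have "Ck_on n S (\<lambda>x. frechet_derivative g (at x) v)" for v
    using Suc.IH[of "\<lambda>x. frechet_derivative f (at x) v"] Suc.prems(2) eq by simp
  then show ?case using D by (auto simp: differentiable_def)
qed

text \<open>Working form of the recursion: any known derivative \<open>f'\<close> may replace
  \<open>frechet_derivative\<close>, so the usual differentiation rules drive the inductions
  below.\<close>

lemma Ck_on_SucI:
  assumes "open S" "\<And>x. x \<in> S \<Longrightarrow> (f has_derivative f' x) (at x)"
    and "\<And>v. Ck_on n S (\<lambda>x. f' x v)"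
  shows "Ck_on (Suc n) S f"
proof -
  have "f' x = frechet_derivative f (at x)" if "x \<in> S" for x
    using assms(2) frechet_derivative_at that by blast
  then have "Ck_on n S (\<lambda>x. frechet_derivative f (at x) v)" for v
    using Ck_on_cong[OF assms(1) _ assms(3)[of v]] by simp
  then show ?thesis using assms(2) by (auto simp: differentiable_def)
qed

lemma Ck_on_SucD:
  assumes "Ck_on (Suc n) S f"
  shows "\<And>x. x \<in> S \<Longrightarrow> (f has_derivative frechet_derivative f (at x)) (at x)"
    and "Ck_on n S (\<lambda>x. frechet_derivative f (at x) v)"
  using assms by (auto simp: frechet_derivative_works[symmetric])

lemma Ck_on_Suc_imp: "Ck_on (Suc n) S f \<Longrightarrow> Ck_on n S f"
proof (induction n arbitrary: f)
  case 0
  then show ?case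
    by (auto intro!: differentiable_imp_continuous_on differentiable_at_imp_differentiable_on)
next
  case (Suc n)
  then show ?case
    by (metis Ck_on.simps(2))
qed

lemma Ck_on_subset: "Ck_on n S f \<Longrightarrow> T \<subseteq> S \<Longrightarrow> Ck_on n T f"
  by (induction n arbitrary: f) (auto intro: continuous_on_subset)

lemma Ck_on_const: "open S \<Longrightarrow> Ck_on n S (\<lambda>x. c)"
  by (induction n arbitrary: c) (auto intro: Ck_on_SucI[where f' = "\<lambda>x v. 0"] simp del: Ck_on.simps(2))

lemma Ck_on_bounded_linear: "open S \<Longrightarrow> bounded_linear f \<Longrightarrow> Ck_on n S f"
  by (cases n) (auto intro!: Ck_on_SucI[where f' = "\<lambda>x. f"] Ck_on_const bounded_linear_imp_has_derivative
      linear_continuous_on simp del: Ck_on.simps(2))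

lemma Ck_on_add:
  assumes "open S" "Ck_on n S f" "Ck_on n S g"
  shows "Ck_on n S (\<lambda>x. f x + g x)"
  using assms(2,3)
proof (induction n arbitrary: f g)
  case 0 then show ?case by (auto intro: continuous_intros)
next
  case (Suc n)
  note D = Ck_on_SucD[OF Suc.prems(1)] Ck_on_SucD[OF Suc.prems(2)]
  show ?case
    by (rule Ck_on_SucI[OF \<open>open S\<close> has_derivative_add[OF D(1) D(3)]]; assumption?)
      (intro Suc.IH D)
qed

lemma Ck_on_sum:
  assumes "open S" "finite I" "\<And>i. i \<in> I \<Longrightarrow> Ck_on n S (f i)"
  shows "Ck_on n S (\<lambda>x. \<Sum>i\<in>I. f i x)"
  using assms(2,3)
  by (induction I rule: finite_induct) (auto intro: Ck_on_const Ck_on_add assms(1))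

lemma Ck_on_scaleR:
  fixes f :: "'a::euclidean_space \<Rightarrow> real"
  assumes "open S" "Ck_on n S f" "Ck_on n S g"
  shows "Ck_on n S (\<lambda>x. f x *\<^sub>R g x)"
  using assms(2,3)
proof (induction n arbitrary: f g)
  case 0 then show ?case by (auto intro: continuous_intros)
next
  case (Suc n)
  note D = Ck_on_SucD[OF Suc.prems(1)] Ck_on_SucD[OF Suc.prems(2)]
  show ?case
    by (rule Ck_on_SucI[OF \<open>open S\<close> has_derivative_scaleR[OF D(1) D(3)]]; assumption?)
      (rule Ck_on_add[OF \<open>open S\<close> Suc.IH[OF Ck_on_Suc_imp[OF Suc.prems(1)] D(4)]
        Suc.IH[OF D(2) Ck_on_Suc_imp[OF Suc.prems(2)]]])
qed

lemma Ck_on_mult: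
  fixes f g :: "'a::euclidean_space \<Rightarrow> real"
  assumes "open S" "Ck_on n S f" "Ck_on n S g"
  shows "Ck_on n S (\<lambda>x. f x * g x)"
  using Ck_on_scaleR[OF assms] by simp

lemma Ck_on_linear_compose:
  assumes "open S" "bounded_linear h" "Ck_on n S f"
  shows "Ck_on n S (\<lambda>x. h (f x))"
  using assms(3)
proof (induction n arbitrary: f)
  case 0 then show ?case using linear_continuous_on_compose[OF _ bounded_linear.linear[OF assms(2)]] by auto
next
  case (Suc n)
  note D = Ck_on_SucD[OF Suc.prems(1)]
  show ?case
    by (rule Ck_on_SucI[OF \<open>open S\<close> bounded_linear.has_derivative[OF assms(2) D(1)]]; assumption?)
      (intro Suc.IH D)
qed

lemma linear_representation:
  assumes "linear (A :: 'a::euclidean_space \<Rightarrow> 'b::real_vector)"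
  shows "(\<Sum>b\<in>Basis. (w \<bullet> b) *\<^sub>R A b) = A w"
  using linear_sum[OF assms, of "\<lambda>b. (w \<bullet> b) *\<^sub>R b" Basis]
  by (simp add: linear_scale[OF assms] euclidean_representation)

text \<open>Induction through the chain rule. \<open>Ck_on\<close> controls derivatives in fixed
  directions, whereas the chain rule applies the derivative of \<open>f\<close> to a direction
  varying with \<open>x\<close>. Expanding that direction in \<open>Basis\<close> reduces everything
  to sums and products.\<close>

lemma Ck_on_compose:
  assumes "open S" "open T" "Ck_on n T f" "Ck_on n S g" "g ` S \<subseteq> T"
  shows "Ck_on n S (\<lambda>x. f (g x))"
  using assms(3,4)
proof (induction n arbitrary: f)
  case 0 then show ?case using assms(5) by (auto intro: continuous_on_compose2)
next
  case (Suc n)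
  note D = Ck_on_SucD[OF Suc.prems(1)] Ck_on_SucD[OF Suc.prems(2)]
  have "((\<lambda>x. f (g x)) has_derivative
      (\<lambda>v. \<Sum>b\<in>Basis. (frechet_derivative g (at x) v \<bullet> b) *\<^sub>R frechet_derivative f (at (g x)) b)) (at x)"
    if "x \<in> S" for x
  proof -
    have "linear (frechet_derivative f (at (g x)))"
      using D(1) assms(5) that by (blast intro: has_derivative_linear)
    moreover have "((\<lambda>x. f (g x)) has_derivative (\<lambda>v. frechet_derivative f (at (g x)) (frechet_derivative g (at x) v))) (at x)"
      using has_derivative_compose[OF D(3) D(1)] assms(5) that by blast
    ultimately show ?thesis by (simp add: linear_representation)
  qed
  moreover have "Ck_on n S (\<lambda>x. \<Sum>b\<in>Basis. (frechet_derivative g (at x) v \<bullet> b) *\<^sub>R frechet_derivative f (at (g x)) b)" for v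
  proof (rule Ck_on_sum[OF \<open>open S\<close> finite_Basis], rule Ck_on_scaleR[OF \<open>open S\<close>])
    fix b :: 'b
    show "Ck_on n S (\<lambda>x. frechet_derivative g (at x) v \<bullet> b)"
      by (rule Ck_on_linear_compose[OF \<open>open S\<close> bounded_linear_inner_left D(4)])
    show "Ck_on n S (\<lambda>x. frechet_derivative f (at (g x)) b)"
      by (rule Suc.IH[OF D(2) Ck_on_Suc_imp[OF Suc.prems(2)]])
  qed
  ultimately show ?case
    by (rule Ck_on_SucI[OF \<open>open S\<close>])
qed

text \<open>The derivative of 1/f is a product of 1/f, twice, and the derivative of
  \<open>f\<close>, so order \<open>n\<close> for 1/f gives order \<open>n + 1\<close>.\<close>

lemma Ck_on_inverse:
  fixes f :: "'a::euclidean_space \<Rightarrow> real"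
  assumes "open S" "Ck_on n S f" "\<And>x. x \<in> S \<Longrightarrow> f x \<noteq> 0"
  shows "Ck_on n S (\<lambda>x. inverse (f x))"
  using assms(2)
proof (induction n)
  case 0 then show ?case using assms(3) by (auto intro: continuous_intros)
next
  case (Suc n)
  note D = Ck_on_SucD[OF Suc.prems(1)]
  have IH: "Ck_on n S (\<lambda>x. inverse (f x))" using Suc Ck_on_Suc_imp by blast
  have "((\<lambda>x. inverse (f x)) has_derivative
     (\<lambda>v. (- 1) * (inverse (f x) * frechet_derivative f (at x) v * inverse (f x)))) (at x)" if "x \<in> S" for x
    using Deriv.has_derivative_inverse[OF assms(3) D(1)] that by simp
  moreover have "Ck_on n S (\<lambda>x. (- 1) * (inverse (f x) * frechet_derivative f (at x) v * inverse (f x)))" for v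
    by (rule Ck_on_mult[OF \<open>open S\<close> Ck_on_const[OF \<open>open S\<close>]
          Ck_on_mult[OF \<open>open S\<close> Ck_on_mult[OF \<open>open S\<close> IH D(2)] IH]])
  ultimately show ?case
    by (rule Ck_on_SucI[OF \<open>open S\<close>])
qed

lemma Ck_on_sin_cos: "Ck_on n UNIV (sin :: real \<Rightarrow> real) \<and> Ck_on n UNIV (cos :: real \<Rightarrow> real)"
proof (induction n)
  case 0 then show ?case by (auto intro: continuous_intros)
next
  case (Suc n)
  have s: "((sin :: real \<Rightarrow> real) has_derivative (\<lambda>v. v * cos x)) (at x)"
    and c: "((cos :: real \<Rightarrow> real) has_derivative (\<lambda>v. (- v) * sin x)) (at x)" for x
    by (auto intro!: derivative_eq_intros)
  show ?case
    using Suc by (intro conjI Ck_on_SucI[OF open_UNIV s] Ck_on_SucI[OF open_UNIV c] Ck_on_mult Ck_on_const) auto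
qed

lemma smooth_on_const: "open S \<Longrightarrow> smooth_on S (\<lambda>x. c)"
  and smooth_on_bounded_linear: "open S \<Longrightarrow> bounded_linear f \<Longrightarrow> smooth_on S f"
  and smooth_on_add: "open S \<Longrightarrow> smooth_on S g \<Longrightarrow> smooth_on S h \<Longrightarrow> smooth_on S (\<lambda>x. g x + h x)"
  and smooth_on_linear_compose:
    "open S \<Longrightarrow> bounded_linear l \<Longrightarrow> smooth_on S g \<Longrightarrow> smooth_on S (\<lambda>x. l (g x))"
  by (auto simp: smooth_on_def intro: Ck_on_const Ck_on_bounded_linear Ck_on_add Ck_on_linear_compose)

lemma smooth_on_mult:
  "open S \<Longrightarrow> smooth_on S (g :: _ \<Rightarrow> real) \<Longrightarrow> smooth_on S h \<Longrightarrow> smooth_on S (\<lambda>x. g x * h x)"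
  by (simp add: smooth_on_def Ck_on_mult)

lemma smooth_on_inverse:
  "open S \<Longrightarrow> smooth_on S (g :: _ \<Rightarrow> real) \<Longrightarrow> (\<And>x. x \<in> S \<Longrightarrow> g x \<noteq> 0) \<Longrightarrow> smooth_on S (\<lambda>x. inverse (g x))"
  by (simp add: smooth_on_def Ck_on_inverse)

lemma smooth_on_compose:
  "open S \<Longrightarrow> open T \<Longrightarrow> smooth_on T f \<Longrightarrow> smooth_on S g \<Longrightarrow> g ` S \<subseteq> T \<Longrightarrow> smooth_on S (\<lambda>x. f (g x))"
  by (simp add: smooth_on_def Ck_on_compose)

lemma smooth_on_subset: "smooth_on S f \<Longrightarrow> T \<subseteq> S \<Longrightarrow> smooth_on T f"
  by (auto simp: smooth_on_def intro: Ck_on_subset)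

lemma smooth_on_imp_has_derivative:
  "smooth_on S f \<Longrightarrow> x \<in> S \<Longrightarrow> (f has_derivative frechet_derivative f (at x)) (at x)"
  unfolding smooth_on_def by (metis Ck_on_SucD(1))

lemma smooth_on_diff:
  assumes "open S" "smooth_on S g" "smooth_on S h"
  shows "smooth_on S (\<lambda>x. g x - h x)"
  using smooth_on_add[OF assms(1,2) smooth_on_linear_compose[OF assms(1) bounded_linear_minus[OF bounded_linear_ident] assms(3)]]
  by simp

lemma smooth_on_Pair:
  assumes "open S" "smooth_on S g" "smooth_on S h"
  shows "smooth_on S (\<lambda>x. (g x, h x))"
proof -
  have "bounded_linear (\<lambda>a::'b. (a, 0::'c))" "bounded_linear (\<lambda>b::'c. (0::'b, b))"
    by (intro bounded_linear_Pair bounded_linear_ident bounded_linear_zero)+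
  then show ?thesis
    using smooth_on_add[OF assms(1) smooth_on_linear_compose[OF assms(1) _ assms(2)]
        smooth_on_linear_compose[OF assms(1) _ assms(3)]] by fastforce
qed

section \<open>The smooth inverse function theorem\<close>

text \<open>A product rule with a merely continuous factor \<open>c\<close>: since \<open>d\<close>
  vanishes at \<open>x\<close>, the variation of \<open>c\<close> is multiplied by something of
  first order. It serves to differentiate an inverse matrix before its entries are known to be
  differentiable.\<close>

lemma has_derivative_scaleR_vanishing:
  fixes c :: "'a::real_normed_vector \<Rightarrow> real"
  assumes c: "isCont c x" and d: "(d has_derivative d') (at x)" and "d x = 0"
  shows "((\<lambda>y. c y *\<^sub>R d y) has_derivative (\<lambda>h. c x *\<^sub>R d' h)) (at x)"
proof -
  have bl: "bounded_linear d'" using d by (rule has_derivative_bounded_linear)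
  obtain K where K: "\<And>h. norm (d' h) \<le> norm h * K" using bounded_linear.bounded[OF bl] by blast
  have "((\<lambda>y. (1 / norm (y - x)) *\<^sub>R (d y - d' (y - x))) \<longlongrightarrow> 0) (at x)"
    using d \<open>d x = 0\<close> by (simp add: has_derivative_within)
  then have 1: "((\<lambda>y. c y *\<^sub>R ((1 / norm (y - x)) *\<^sub>R (d y - d' (y - x)))) \<longlongrightarrow> 0) (at x)"
    using tendsto_scaleR[OF c[unfolded isCont_def]] by fastforce
  have "((\<lambda>y. norm (c y - c x) * K) \<longlongrightarrow> 0) (at x)"
    using tendsto_mult_right[OF tendsto_norm[OF LIM_zero[OF c[unfolded isCont_def]]], of K] by simp
  then have 2: "((\<lambda>y. (c y - c x) *\<^sub>R ((1 / norm (y - x)) *\<^sub>R d' (y - x))) \<longlongrightarrow> 0) (at x)"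
  proof (rule Lim_null_comparison[rotated], intro always_eventually allI)
    fix y
    show "norm ((c y - c x) *\<^sub>R ((1 / norm (y - x)) *\<^sub>R d' (y - x))) \<le> norm (c y - c x) * K"
    proof (cases "y = x")
      case False
      then have "norm ((1 / norm (y - x)) *\<^sub>R d' (y - x)) \<le> K"
        using K[of "y - x"] by (simp add: divide_simps mult.commute)
      then show ?thesis
        unfolding norm_scaleR[of "c y - c x"] real_norm_def[of "c y - c x"] by (rule mult_left_mono) simp
    qed simp
  qed
  \<comment> \<open>The quotient splits into \<open>c\<close> times the remainder of
    \<open>d\<close>, and the increment of \<open>c\<close> times a bounded quotient; both tend to
    zero.\<close>
  have "(1 / norm (y - x)) *\<^sub>R (c y *\<^sub>R d y - (c x *\<^sub>R d x + c x *\<^sub>R d' (y - x)))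
      = c y *\<^sub>R ((1 / norm (y - x)) *\<^sub>R (d y - d' (y - x))) + (c y - c x) *\<^sub>R ((1 / norm (y - x)) *\<^sub>R d' (y - x))" for y
    using \<open>d x = 0\<close> by (simp add: algebra_simps diff_divide_distrib)
  then show ?thesis
    using tendsto_add[OF 1 2] bounded_linear_scaleR_right[THEN bounded_linear_compose, OF bl]
    by (simp add: has_derivative_within o_def)
qed

text \<open>Write W for the solution of A(y) W(y) = v. Then A(y0) (W(y) - W(y0)) = (A(y0) - A(y))
  W(y), and the lower bound of the invertible map A(y0) turns this into an estimate of the increment
  of W.\<close>

lemma continuous_on_linear_inv:
  fixes A :: "'c::euclidean_space \<Rightarrow> 'a::euclidean_space \<Rightarrow> 'a"
  assumes lin: "\<And>y. y \<in> V \<Longrightarrow> linear (A y)" and bij: "\<And>y. y \<in> V \<Longrightarrow> bij (A y)"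
    and A: "\<And>v. continuous_on V (\<lambda>y. A y v)"
  shows "continuous_on V (\<lambda>y. inv (A y) v)"
  unfolding continuous_on_def
proof
  fix y0 assume y0: "y0 \<in> V"
  let ?W = "\<lambda>y. inv (A y) v"
  \<comment> \<open>A bound for the operator norm of the difference that uses only the values on
    \<open>Basis\<close>, which are known to be continuous.\<close>
  let ?\<delta> = "\<lambda>y. \<Sum>b\<in>Basis. norm (A y b - A y0 b)"
  obtain c where c: "c > 0" "\<And>x. c * norm x \<le> norm (A y0 x)"
    using linear_inj_bounded_below_pos[OF lin[OF y0] bij_is_inj[OF bij[OF y0]]] by blast
  have \<delta>: "norm (A y w - A y0 w) \<le> ?\<delta> y * norm w" if "y \<in> V" for y w
  proof -
    have "A y w - A y0 w = (\<Sum>b\<in>Basis. (w \<bullet> b) *\<^sub>R (A y b - A y0 b))"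
      using linear_representation[OF lin[OF that], of w] linear_representation[OF lin[OF y0], of w]
      by (simp add: scaleR_diff_right sum_subtractf)
    also have "norm \<dots> \<le> (\<Sum>b\<in>Basis. norm w * norm (A y b - A y0 b))"
      by (rule sum_norm_le) (auto intro!: mult_right_mono Basis_le_norm)
    finally show ?thesis by (simp add: sum_distrib_left mult.commute)
  qed
  have "(?\<delta> \<longlongrightarrow> ?\<delta> y0) (at y0 within V)"
    using A y0 by (intro tendsto_intros) (auto simp: continuous_on_def)
  then have lim: "(?\<delta> \<longlongrightarrow> 0) (at y0 within V)" by simp
  \<comment> \<open>Below \<open>c / 2\<close> the perturbation can be absorbed into the lower bound
    \<open>c\<close>, which keeps \<open>?W y\<close> bounded near \<open>y0\<close>.\<close>
  have "\<forall>\<^sub>F y in at y0 within V. ?\<delta> y < c / 2"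
    using order_tendstoD(2)[OF lim, of "c / 2"] c(1) by (simp del: less_divide_eq_numeral1)
  moreover have "\<forall>\<^sub>F y in at y0 within V. y \<in> V" by (simp add: eventually_at_filter)
  ultimately have "\<forall>\<^sub>F y in at y0 within V. norm (?W y - ?W y0) \<le> ?\<delta> y * (2 * norm v / (c * c))"
  proof eventually_elim
    case (elim y)
    have AW: "A y (?W y) = v" "A y0 (?W y0) = v"
      using bij elim(2) y0 by (simp_all add: bij_is_surj surj_f_inv_f)
    have "c * norm (?W y) \<le> norm (A y0 (?W y))" by (rule c)
    also have "\<dots> \<le> norm v + ?\<delta> y * norm (?W y)"
      using \<delta>[OF elim(2), of "?W y"] norm_triangle_ineq2[of "A y0 (?W y)" v] AW(1)
      by (simp add: norm_minus_commute)
    also have "\<dots> \<le> norm v + (c / 2) * norm (?W y)"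
      using elim(1) by (intro add_left_mono mult_right_mono) auto
    finally have W: "norm (?W y) \<le> 2 * norm v / c" using c(1) by (simp add: field_simps)
    have "c * norm (?W y - ?W y0) \<le> norm (A y0 (?W y - ?W y0))" by (rule c)
    also have "\<dots> = norm (A y (?W y) - A y0 (?W y))"
      using AW by (simp add: linear_diff[OF lin[OF y0]] norm_minus_commute)
    also have "\<dots> \<le> ?\<delta> y * norm (?W y)" by (rule \<delta>[OF elim(2)])
    also have "\<dots> \<le> ?\<delta> y * (2 * norm v / c)" using W by (intro mult_left_mono sum_nonneg) auto
    finally show ?case using c(1) by (simp add: field_simps)
  qed
  moreover have "((\<lambda>y. ?\<delta> y * (2 * norm v / (c * c))) \<longlongrightarrow> 0) (at y0 within V)"
    using tendsto_mult_right[OF lim, of "2 * norm v / (c * c)"] by simp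
  ultimately have "((\<lambda>y. ?W y - ?W y0) \<longlongrightarrow> 0) (at y0 within V)"
    by (rule Lim_null_comparison)
  then show "(?W \<longlongrightarrow> ?W y0) (at y0 within V)" by (rule LIM_zero_cancel)
qed

text \<open>Differentiating \<open>A y (inv (A y) v) = v\<close> expresses the derivative of the inverse through
  the inverse itself and the derivative of \<open>A\<close>, which allows induction on the order.\<close>

lemma Ck_on_linear_inv:
  fixes A :: "'c::euclidean_space \<Rightarrow> 'a::euclidean_space \<Rightarrow> 'a"
  assumes "open V" and lin: "\<And>y. y \<in> V \<Longrightarrow> linear (A y)" and bij: "\<And>y. y \<in> V \<Longrightarrow> bij (A y)"
    and A: "\<And>v. Ck_on n V (\<lambda>y. A y v)"
  shows "Ck_on n V (\<lambda>y. inv (A y) v)"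
  using A
proof (induction n arbitrary: v)
  case 0
  then have "\<And>v. continuous_on V (\<lambda>y. A y v)" by simp
  from continuous_on_linear_inv[OF lin bij this] show ?case by simp
next
  case (Suc n)
  let ?W = "\<lambda>y. inv (A y) v"
  let ?A' = "\<lambda>b y u. frechet_derivative (\<lambda>y. A y b) (at y) u"
  let ?D = "\<lambda>y u. (-1) *\<^sub>R (\<Sum>b\<in>Basis. (?W y \<bullet> b) *\<^sub>R (\<Sum>c\<in>Basis. (?A' b y u \<bullet> c) *\<^sub>R inv (A y) c))"
  have IH: "Ck_on n V (\<lambda>y. inv (A y) w)" for w
    by (rule Suc.IH) (rule Ck_on_Suc_imp[OF Suc.prems])
  have "continuous_on V ?W"
    by (rule continuous_on_linear_inv[OF lin bij])
      (use Suc.prems in \<open>auto intro!: differentiable_imp_continuous_on differentiable_at_imp_differentiable_on\<close>)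
  have "(?W has_derivative ?D y0) (at y0)" if y0: "y0 \<in> V" for y0
  proof -
    have cW: "isCont ?W y0"
      using \<open>continuous_on V ?W\<close> \<open>open V\<close> y0 by (simp add: continuous_on_eq_continuous_at)
    have linv: "linear (inv (A y0))"
      using lin[OF y0] bij[OF y0] by (simp add: inj_linear_imp_inv_linear bij_is_inj)
    have D: "((\<lambda>y. A y b - A y0 b) has_derivative ?A' b y0) (at y0)" for b
      using has_derivative_diff[OF Ck_on_SucD(1)[OF Suc.prems y0] has_derivative_const, of b] by simp
    \<comment> \<open>Each summand has a coefficient that is only known to be continuous and a
      factor vanishing at \<open>y0\<close>, so the special product rule applies.\<close>
    have "((\<lambda>y. \<Sum>b\<in>Basis. (?W y \<bullet> b) *\<^sub>R (A y b - A y0 b)) has_derivative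
        (\<lambda>u. \<Sum>b\<in>Basis. (?W y0 \<bullet> b) *\<^sub>R ?A' b y0 u)) (at y0)"
      by (intro has_derivative_sum has_derivative_scaleR_vanishing D)
        (use cW in \<open>auto intro: continuous_intros\<close>)
    from bounded_linear.has_derivative[OF linear_linear[THEN iffD2, OF linv] this]
    have "((\<lambda>y. inv (A y0) v + (-1) *\<^sub>R inv (A y0) (\<Sum>b\<in>Basis. (?W y \<bullet> b) *\<^sub>R (A y b - A y0 b)))
       has_derivative (\<lambda>u. (-1) *\<^sub>R inv (A y0) (\<Sum>b\<in>Basis. (?W y0 \<bullet> b) *\<^sub>R ?A' b y0 u))) (at y0)"
      by (auto intro!: derivative_eq_intros)
    \<comment> \<open>The sum equals A(y) W(y) - A(y0) W(y) = v - A(y0) W(y). Applying the inverse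
      of A(y0) isolates W(y), which is thus expressed through a function already
      differentiated.\<close>
    moreover have "inv (A y0) v + (-1) *\<^sub>R inv (A y0) (\<Sum>b\<in>Basis. (?W y \<bullet> b) *\<^sub>R (A y b - A y0 b)) = ?W y"
      if "y \<in> V" for y
    proof -
      have "(\<Sum>b\<in>Basis. (?W y \<bullet> b) *\<^sub>R (A y b - A y0 b)) = A y (?W y) - A y0 (?W y)"
        using linear_representation[OF lin[OF that], of "?W y"] linear_representation[OF lin[OF y0], of "?W y"]
        by (simp add: scaleR_diff_right sum_subtractf)
      then show ?thesis
        using bij[OF that] bij[OF y0]
        by (simp add: linear_diff[OF linv] bij_is_surj surj_f_inv_f bij_is_inj inv_f_f)
    qed
    moreover have "(\<lambda>u. (-1) *\<^sub>R inv (A y0) (\<Sum>b\<in>Basis. (?W y0 \<bullet> b) *\<^sub>R ?A' b y0 u)) = ?D y0"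
      by (simp add: linear_sum[OF linv] linear_scale[OF linv] linear_representation[OF linv])
    ultimately show ?thesis
      using has_derivative_transform_within_open[OF _ \<open>open V\<close> y0] by (metis (no_types, lifting))
  qed
  moreover have "Ck_on n V (\<lambda>y. ?D y u)" for u
    by (rule Ck_on_linear_compose[OF \<open>open V\<close> bounded_linear_scaleR_right],
        rule Ck_on_sum[OF \<open>open V\<close> finite_Basis],
        rule Ck_on_scaleR[OF \<open>open V\<close> Ck_on_linear_compose[OF \<open>open V\<close> bounded_linear_inner_left IH]],
        rule Ck_on_sum[OF \<open>open V\<close> finite_Basis],
        rule Ck_on_scaleR[OF \<open>open V\<close>
          Ck_on_linear_compose[OF \<open>open V\<close> bounded_linear_inner_left Ck_on_SucD(2)[OF Suc.prems]] IH])
  ultimately show ?case by (rule Ck_on_SucI[OF \<open>open V\<close>])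
qed

text \<open>The inverse function theorem supplies a differentiable inverse g with derivative
  f'(g(y)) inverted. Bootstrapping: if g is of order n, then so is f'(g(y)), hence so is its
  inverse, and g is of order n + 1.\<close>

lemma smooth_inverse_function:
  fixes f :: "'a::euclidean_space \<Rightarrow> 'a"
  assumes "open U" "x0 \<in> U" "smooth_on U f" "(f has_derivative f0) (at x0)" "bij f0"
  obtains U' V g where "open U'" "U' \<subseteq> U" "x0 \<in> U'" "open V" "homeomorphism U' V f g"
    "smooth_on V g" "(g has_derivative inv f0) (at (f x0))"
proof -
  define F where "F x = Blinfun (frechet_derivative f (at x))" for x
  have Ck: "Ck_on n U f" for n using assms(3) by (simp add: smooth_on_def)
  have D: "(f has_derivative frechet_derivative f (at x)) (at x)" if "x \<in> U" for x
    using Ck_on_SucD(1)[OF Ck that] .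
  have F: "blinfun_apply (F x) = frechet_derivative f (at x)" if "x \<in> U" for x
    using D[OF that] by (simp add: F_def bounded_linear_Blinfun_apply has_derivative_bounded_linear)
  have f0: "frechet_derivative f (at x0) = f0"
    using frechet_derivative_at[OF assms(4)] by simp
  have linf0: "linear f0" using assms(4) by (rule has_derivative_linear)
  have "continuous_on U F"
  proof (rule continuous_on_blinfun_componentwise)
    fix i
    have "continuous_on U (\<lambda>x. frechet_derivative f (at x) i)"
      using Ck_on_SucD(2)[OF Ck[of 1, unfolded One_nat_def]] by simp
    then show "continuous_on U (\<lambda>x. blinfun_apply (F x) i)" using F by (simp cong: continuous_on_cong)
  qed
  moreover have "Blinfun (inv f0) o\<^sub>L F x0 = id_blinfun"
    using F[OF assms(2)] f0 inj_linear_imp_inv_linear[OF linf0 bij_is_inj[OF assms(5)]] assms(5)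
    by (intro blinfun_eqI) (simp add: bounded_linear_Blinfun_apply linear_linear bij_is_inj inv_f_f)
  ultimately obtain U' V g g' where g: "open U'" "U' \<subseteq> U" "x0 \<in> U'" "open V" "f x0 \<in> V"
      "homeomorphism U' V f g"
      "\<And>y. y \<in> V \<Longrightarrow> (g has_derivative (g' y)) (at y)"
      "\<And>y. y \<in> V \<Longrightarrow> g' y = inv (blinfun_apply (F (g y)))"
      "\<And>y. y \<in> V \<Longrightarrow> bij (blinfun_apply (F (g y)))"
    using inverse_function_theorem[OF \<open>open U\<close>, of f F x0 "Blinfun (inv f0)"] D F assms(2)
    by (metis (no_types, lifting))
  have gV: "g ` V \<subseteq> U" using g(2,6) by (auto simp: homeomorphism_def)
  have "Ck_on n V g" for n
  proof (induction n)
    case 0 then show ?case using g(6) by (simp add: homeomorphism_def)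
  next
    case (Suc n)
    have "Ck_on n V (\<lambda>y. inv (frechet_derivative f (at (g y))) v)" for v
    proof (rule Ck_on_linear_inv[OF \<open>open V\<close>])
      fix y assume y: "y \<in> V"
      then have "g y \<in> U" using gV by blast
      then show "linear (frechet_derivative f (at (g y)))" "bij (frechet_derivative f (at (g y)))"
        using D g(9)[OF y] F by (auto intro: has_derivative_linear)
    next
      show "Ck_on n V (\<lambda>y. frechet_derivative f (at (g y)) v)" for v
        by (rule Ck_on_compose[OF \<open>open V\<close> \<open>open U\<close> Ck_on_SucD(2)[OF Ck] Suc gV])
    qed
    moreover have "(g has_derivative inv (frechet_derivative f (at (g y)))) (at y)" if "y \<in> V" for y
      using g(7,8)[OF that] F gV that by auto
    ultimately show ?case by (intro Ck_on_SucI[OF \<open>open V\<close>])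
  qed
  moreover have "g (f x0) = x0" using g(3,6) by (auto simp: homeomorphism_def)
  ultimately show thesis
    using that g(1-6) g(7,8)[OF g(5)] F[OF assms(2)] f0 by (simp add: smooth_on_def)
qed

section \<open>Regular level sets\<close>

text \<open>If \<open>A\<close> is the derivative of \<open>G\<close> and \<open>R\<close> is a right inverse of \<open>A\<close>, then
  \<open>\<phi> y = y + R (G y - A y)\<close> has derivative the identity and satisfies \<open>A \<circ> \<phi> = G\<close>, so it maps the
  level set of \<open>G\<close> to the kernel of \<open>A\<close>.\<close>

lemma regular_level_chart:
  fixes G :: "'a::euclidean_space \<Rightarrow> 'b::euclidean_space"
  assumes "open S" "x \<in> S" "smooth_on S G" "(G has_derivative A) (at x)" "surj A"
  obtains U V \<phi> \<psi> where "open U" "U \<subseteq> S" "x \<in> U" "open V" "homeomorphism U V \<phi> \<psi>"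
    "smooth_on U \<phi>" "smooth_on V \<psi>" "\<And>y. A (\<phi> y) = G y"
    "(\<psi> has_derivative (\<lambda>v. v)) (at (\<phi> x))"
proof -
  have linA: "linear A" and blA: "bounded_linear A"
    using assms(4) by (auto intro: has_derivative_linear has_derivative_bounded_linear)
  obtain R where R: "linear R" "A \<circ> R = id"
    using linear_surj_right_inverse[OF linA, of UNIV UNIV] \<open>surj A\<close> by (auto simp: fun_eq_iff)
  have blR: "bounded_linear R" using R(1) by (rule linear_linear[THEN iffD2])
  define \<phi> where "\<phi> y = y + R (G y - A y)" for y
  have sm: "smooth_on S \<phi>"
    unfolding \<phi>_def
    by (intro smooth_on_add[OF assms(1)] smooth_on_linear_compose[OF assms(1) blR] smooth_on_diff[OF assms(1)]
        smooth_on_bounded_linear[OF assms(1) blA] smooth_on_bounded_linear[OF assms(1) bounded_linear_ident] assms(3))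
  have "((\<lambda>y. y + R (G y - A y)) has_derivative (\<lambda>v. v + R (A v - A v))) (at x)"
    by (intro has_derivative_add has_derivative_ident bounded_linear.has_derivative[OF blR]
        has_derivative_diff assms(4) bounded_linear_imp_has_derivative blA)
  then have D: "(\<phi> has_derivative (\<lambda>v. v)) (at x)"
    by (simp add: \<phi>_def[abs_def] linear_0[OF R(1)])
  obtain U V \<psi> where UV: "open U" "U \<subseteq> S" "x \<in> U" "open V" "homeomorphism U V \<phi> \<psi>"
    "smooth_on V \<psi>" "(\<psi> has_derivative inv (\<lambda>v. v)) (at (\<phi> x))"
    by (rule smooth_inverse_function[OF assms(1,2) sm D]) (simp add: bij_id[unfolded id_def], rule that)
  moreover have "inv (\<lambda>v::'a. v) = (\<lambda>v. v)" using inv_id by (simp add: id_def)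
  moreover have "A (\<phi> y) = G y" for y
    using R(2) by (simp add: \<phi>_def linear_add[OF linA] fun_eq_iff)
  ultimately show thesis using that[of U V \<phi> \<psi>] smooth_on_subset[OF sm UV(2)] by simp
qed

text \<open>A right inverse \<open>R\<close> splits every v into v - R(A v), in the kernel, and R(A
  v), in an isomorphic copy of the target.\<close>

lemma dim_kernel_surj:
  fixes A :: "'a::euclidean_space \<Rightarrow> 'b::euclidean_space"
  assumes A: "linear A" "surj A"
  shows "dim {v. A v = 0} + DIM('b) = DIM('a)"
proof -
  obtain R where R: "linear R" "\<And>w. A (R w) = w"
    using linear_surj_right_inverse[OF A(1), of UNIV UNIV] A(2) by auto
  have "v \<in> {x + y |x y. x \<in> {v. A v = 0} \<and> y \<in> range R}" for v
    using R(2) by (intro CollectI exI[of _ "v - R (A v)"] exI[of _ "R (A v)"]) (simp add: linear_diff[OF A(1)])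
  then have "{x + y |x y. x \<in> {v. A v = 0} \<and> y \<in> range R} = UNIV" by (simp add: set_eq_iff)
  moreover have "{v. A v = 0} \<inter> range R = {0}"
    using R linear_0[OF R(1)] by (auto simp: image_iff) metis
  moreover have "dim (range R) = DIM('b)"
    using dim_image_eq[OF R(1), of UNIV] inj_on_inverseI[of UNIV A R] R(2) by simp
  ultimately show ?thesis
    using dim_sums_Int[of "{v. A v = 0}" "range R"] linear_subspace_kernel[OF A(1)]
      linear_subspace_image[OF R(1) subspace_UNIV] by simp
qed

text \<open>The chart \<open>\<phi>\<close> of \<open>regular_level_chart\<close> is a slice chart,
  with the kernel of the derivative as the slice: A(\<phi>(y)) = G(y) makes \<open>\<phi>\<close>
  carry zeros of \<open>G\<close> exactly to kernel vectors.\<close>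

lemma regular_level_submanifold:
  fixes G :: "'a::euclidean_space \<Rightarrow> 'b::euclidean_space"
  assumes "open S" "smooth_on S G" "X = {x \<in> S. G x = 0}"
    and surj: "\<And>x. x \<in> X \<Longrightarrow> surj (frechet_derivative G (at x))"
    and k: "k + DIM('b) = DIM('a)"
  shows "smooth_submanifold k X"
  unfolding smooth_submanifold_def
proof
  fix x assume x: "x \<in> X"
  let ?A = "frechet_derivative G (at x)"
  have xS: "x \<in> S" using x assms(3) by simp
  have D: "(G has_derivative ?A) (at x)" by (rule smooth_on_imp_has_derivative[OF assms(2) xS])
  then have lin: "linear ?A" by (rule has_derivative_linear)
  obtain U V \<phi> \<psi> where UV: "open U" "U \<subseteq> S" "x \<in> U" "open V" "homeomorphism U V \<phi> \<psi>"
    "smooth_on U \<phi>" "smooth_on V \<psi>" "\<And>y. ?A (\<phi> y) = G y"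
    by (rule regular_level_chart[OF assms(1) xS assms(2) D surj[OF x]], rule that)
  have "dim {v. ?A v = 0} = k"
    using dim_kernel_surj[OF lin surj[OF x]] k by simp
  moreover have "\<phi> ` (U \<inter> X) = V \<inter> {v. ?A v = 0}"
  proof -
    have "\<phi> ` U = V" using UV(5) by (simp add: homeomorphism_def)
    then show ?thesis using UV(2,8) assms(3) by (auto 4 3)
  qed
  moreover have "subspace {v. ?A v = 0}" using lin by (rule linear_subspace_kernel)
  ultimately show "\<exists>(U::'a set) (V::'a set) \<phi> \<psi> L. open U \<and> x \<in> U \<and> open V \<and> homeomorphism U V \<phi> \<psi> \<and>
        smooth_on U \<phi> \<and> smooth_on V \<psi> \<and> subspace L \<and> dim L = k \<and> \<phi> ` (U \<inter> X) = V \<inter> L"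
    using UV(1,3-7)
    by - (rule exI[of _ U], rule exI[of _ V], rule exI[of _ \<phi>], rule exI[of _ \<psi>],
        rule exI[of _ "{v. ?A v = 0}"], intro conjI; assumption)
qed

section \<open>Tangent spaces of regular level sets\<close>

text \<open>In the chart the line through \<phi>(x) with direction \<open>v\<close> stays in the
  kernel, so \<open>\<psi>\<close> carries it into the level set. Its velocity at \<open>x\<close>
  is \<open>v\<close> because \<open>\<psi>\<close> has the identity as derivative at
  \<phi>(x).\<close>

lemma kernel_subset_tangent_space:
  fixes G :: "'a::euclidean_space \<Rightarrow> 'b::euclidean_space"
  assumes "open S" "smooth_on S G" "X = {x \<in> S. G x = 0}"
    and D: "(G has_derivative A) (at x)" "surj A" "x \<in> X" and v: "A v = 0"
  shows "v \<in> tangent_space X x"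
proof -
  have xS: "x \<in> S" "G x = 0" using \<open>x \<in> X\<close> assms(3) by auto
  have lin: "linear A" using D(1) by (rule has_derivative_linear)
  obtain U V \<phi> \<psi> where UV: "open U" "U \<subseteq> S" "x \<in> U" "open V" "homeomorphism U V \<phi> \<psi>"
    "smooth_on U \<phi>" "smooth_on V \<psi>" "\<And>y. A (\<phi> y) = G y"
    "(\<psi> has_derivative (\<lambda>v. v)) (at (\<phi> x))"
    by (rule regular_level_chart[OF assms(1) xS(1) assms(2) D(1,2)], rule that)
  define l where "l t = \<phi> x + t *\<^sub>R v" for t :: real
  have "\<phi> x \<in> V" using UV(3,5) by (auto simp: homeomorphism_def)
  moreover have "isCont l 0" unfolding l_def by (intro continuous_intros)
  ultimately have "\<forall>\<^sub>F t in at 0. l t \<in> V"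
    using UV(4) by (metis isCont_def topological_tendstoD l_def scaleR_zero_left add.right_neutral)
  then obtain \<epsilon> where \<epsilon>: "\<epsilon> > 0" "\<And>t. t \<noteq> 0 \<Longrightarrow> \<bar>t\<bar> < \<epsilon> \<Longrightarrow> l t \<in> V"
    unfolding eventually_at by (auto simp: dist_real_def)
  have lV: "l ` {-\<epsilon><..<\<epsilon>} \<subseteq> V"
  proof clarify
    fix t assume "t \<in> {-\<epsilon><..<\<epsilon>}"
    then show "l t \<in> V" using \<epsilon>(2)[of t] \<open>\<phi> x \<in> V\<close> by (cases "t = 0") (auto simp: l_def)
  qed
  have "smooth_on {-\<epsilon><..<\<epsilon>} l"
    unfolding l_def by (intro smooth_on_add smooth_on_const smooth_on_bounded_linear bounded_linear_scaleR_left) auto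
  then have "smooth_on {-\<epsilon><..<\<epsilon>} (\<lambda>t. \<psi> (l t))"
    by (rule smooth_on_compose[OF open_greaterThanLessThan UV(4,7) _ lV])
  moreover have "(\<lambda>t. \<psi> (l t)) ` {-\<epsilon><..<\<epsilon>} \<subseteq> X"
  proof clarify
    fix t assume "t \<in> {-\<epsilon><..<\<epsilon>}"
    then have "l t \<in> V" using lV by blast
    then have "\<phi> (\<psi> (l t)) = l t" "\<psi> (l t) \<in> U" using UV(5) by (auto simp: homeomorphism_def)
    moreover have "A (l t) = 0"
      using UV(8)[of x] xS(2) v by (simp add: l_def linear_add[OF lin] linear_scale[OF lin])
    ultimately show "\<psi> (l t) \<in> X" using UV(2) UV(8)[of "\<psi> (l t)"] assms(3) by auto
  qed
  moreover have "\<psi> (l 0) = x" using UV(3,5) by (simp add: l_def homeomorphism_def)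
  moreover have "((\<lambda>t. \<psi> (l t)) has_vector_derivative v) (at 0)"
  proof -
    have "(l has_derivative (\<lambda>t. t *\<^sub>R v)) (at 0)"
      unfolding l_def by (auto intro!: derivative_eq_intros)
    then show ?thesis
      using has_derivative_compose[of l _ 0 UNIV \<psi> "\<lambda>v. v"] UV(9)
      by (simp add: has_vector_derivative_def l_def)
  qed
  ultimately show ?thesis unfolding tangent_space_def using \<epsilon>(1) by blast
qed

lemma tangent_space_mono: "X \<subseteq> Y \<Longrightarrow> tangent_space X x \<subseteq> tangent_space Y x"
  unfolding tangent_space_def by blast

lemma tangent_space_subset_kernel:
  assumes "v \<in> tangent_space X x" "(G has_derivative A) (at x)" "\<And>y. y \<in> X \<Longrightarrow> G y = 0"
  shows "A v = 0"
proof -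
  obtain \<epsilon> \<gamma> where \<gamma>: "\<epsilon> > 0" "\<gamma> ` {-\<epsilon><..<\<epsilon>} \<subseteq> X" "\<gamma> 0 = x" "(\<gamma> has_vector_derivative v) (at 0)"
    using assms(1) unfolding tangent_space_def by blast
  have "((\<lambda>t. G (\<gamma> t)) has_derivative (\<lambda>t. A (t *\<^sub>R v))) (at 0)"
    using has_derivative_compose[of \<gamma> _ 0 UNIV G A] \<gamma>(3,4) assms(2) by (simp add: has_vector_derivative_def)
  moreover have "((\<lambda>t. G (\<gamma> t)) has_derivative (\<lambda>t. 0)) (at 0)"
    by (rule has_derivative_transform_within_open[of "\<lambda>t. 0" _ _ _ "{-\<epsilon><..<\<epsilon>}"])
      (use \<gamma> assms(3) in \<open>auto simp: image_subset_iff\<close>)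
  ultimately have "(\<lambda>t. A (t *\<^sub>R v)) = (\<lambda>t. 0)" by (rule has_derivative_unique)
  then show ?thesis by (metis scaleR_one)
qed

section \<open>Energy estimate\<close>

text \<open>Since 1 + cot(q)^2 = 1/sin(q)^2, the bounds amount to sin q cos q \<le> q \<le> tan q on
  (0, \<pi>/2), where positivity of the cotangent places \<open>q\<close>. The defect is the error
  in replacing q (1 + \<xi>^2) by \<xi> in dH(Y).\<close>

lemma cot_defect_bounds:
  assumes "0 < q" "q < pi" "0 < cot q"
  shows "0 \<le> q * (1 + (cot q)\<^sup>2) - cot q" "q * (1 + (cot q)\<^sup>2) - cot q \<le> 1 / cot q"
proof -
  have s: "sin q > 0" using assms by (simp add: sin_gt_zero)
  have c: "cos q > 0" using assms(3) s by (simp add: cot_def zero_less_divide_iff)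
  then have "q < pi / 2" using assms(1,2) cos_monotone_0_pi_le[of "pi/2" q] by force
  then have t: "q \<le> tan q" using assms(1) abs_tan_ge[of q] c s by (simp add: tan_def)
  have e: "1 + (cot q)\<^sup>2 = 1 / (sin q)\<^sup>2"
    using s sin_cos_squared_add[of q] by (simp add: cot_def field_simps)
  have "sin q * cos q \<le> q * 1"
    using s c assms(1) sin_x_le_x[of q] by (intro mult_mono) auto
  then show "0 \<le> q * (1 + (cot q)\<^sup>2) - cot q"
    unfolding e using s by (simp add: cot_def field_simps power2_eq_square)
  have "q * (1 + (cot q)\<^sup>2) \<le> tan q * (1 + (cot q)\<^sup>2)" using t by (intro mult_right_mono) auto
  also have "tan q * (1 + (cot q)\<^sup>2) = 1 / cot q + cot q"
    using s c by (simp add: cot_def tan_def field_simps power2_eq_square)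
  finally show "q * (1 + (cot q)\<^sup>2) - cot q \<le> 1 / cot q" by simp
qed

text \<open>Low energy forces \<xi> to be large and \<open>m3\<close> to be small, after which \<xi>
  dominates the other two terms of dH(Y). Here \<open>s\<close> stands for the cotangent defect; its
  bounds assume \<xi> > 0, which the proof first has to derive from the energy equation.\<close>

lemma energy_estimate:
  fixes C m1 m2 m3 p \<xi> s h \<epsilon> :: real
  assumes C: "C > 0" "m1\<^sup>2 + m2\<^sup>2 + m3\<^sup>2 = C"
    and \<epsilon>: "\<epsilon> > 0" "\<epsilon> \<le> 1/6" "\<epsilon> \<le> C / 16" "4 * C * \<epsilon> \<le> 1"
    and h: "h \<le> - 4" "(1 + C)\<^sup>2 \<le> 4 * \<epsilon> * (- h)"
    and E: "p\<^sup>2 - m1 * p + (m1\<^sup>2 + m2\<^sup>2 + m3\<^sup>2) / 2 - \<xi> * (1 + m2 * m3) + \<xi>\<^sup>2 * m3\<^sup>2 = h"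
    and s: "\<xi> > 0 \<Longrightarrow> 0 \<le> s" "\<xi> > 0 \<Longrightarrow> s \<le> 1 / \<xi>"
  shows "m1\<^sup>2 + m2\<^sup>2 > 0"
    and "\<xi> + s * (1 + m2 * m3 - 2 * \<xi> * m3\<^sup>2) + m3\<^sup>2 / (m1\<^sup>2 + m2\<^sup>2) * (p * m1 + \<xi> * m2 * m3) > 0"
proof -
  define B where "B = 1 + m2 * m3"
  define r where "r = m1\<^sup>2 + m2\<^sup>2"
  \<comment> \<open>Completing the square in \<open>p\<close> makes every term on the left
    nonnegative, so the right side is at least -h and also bounds the kinetic part.\<close>
  have EB: "(p - m1 / 2)\<^sup>2 + m1\<^sup>2 / 4 + m2\<^sup>2 / 2 + m3\<^sup>2 / 2 + (- h) = \<xi> * B - \<xi>\<^sup>2 * m3\<^sup>2"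
    using E unfolding B_def by (simp add: power2_eq_square field_simps)
  have sq: "0 \<le> m1\<^sup>2" "0 \<le> m2\<^sup>2" "0 \<le> m3\<^sup>2" "0 \<le> (p - m1 / 2)\<^sup>2" "0 \<le> \<xi>\<^sup>2 * m3\<^sup>2" by simp_all
  have low: "- h \<le> \<xi> * B - \<xi>\<^sup>2 * m3\<^sup>2" using EB sq by linarith
  \<comment> \<open>Completing the square in \<xi>: a quadratic with leading coefficient -m3^2
    reaches the value -h only if 4 m3^2 (-h) \<le> B^2. As |B| is at most 1 + C, this makes
    \<open>m3\<close> small.\<close>
  have "4 * m3\<^sup>2 * (\<xi> * B - \<xi>\<^sup>2 * m3\<^sup>2) = B\<^sup>2 - (B - 2 * \<xi> * m3\<^sup>2)\<^sup>2"
    by (simp add: power2_eq_square algebra_simps)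
  then have "4 * m3\<^sup>2 * (\<xi> * B - \<xi>\<^sup>2 * m3\<^sup>2) \<le> B\<^sup>2" by simp
  moreover have "4 * m3\<^sup>2 * (- h) \<le> 4 * m3\<^sup>2 * (\<xi> * B - \<xi>\<^sup>2 * m3\<^sup>2)"
    using low by (intro mult_left_mono) auto
  ultimately have disc: "4 * m3\<^sup>2 * (- h) \<le> B\<^sup>2" by linarith
  have m23: "\<bar>m2 * m3\<bar> \<le> C"
  proof -
    have "2 * \<bar>m2 * m3\<bar> \<le> m2\<^sup>2 + m3\<^sup>2"
      using sum_squares_bound[of "\<bar>m2\<bar>" "\<bar>m3\<bar>"] by (simp add: abs_mult)
    then show ?thesis using C(2) sq by linarith
  qed
  then have "\<bar>B\<bar> \<le> \<bar>1 + C\<bar>" using C(1) unfolding B_def by linarith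
  then have "B\<^sup>2 \<le> (1 + C)\<^sup>2" using abs_le_square_iff by blast
  then have "4 * m3\<^sup>2 * (- h) \<le> 4 * \<epsilon> * (- h)" using disc h(2) by linarith
  then have m3: "m3\<^sup>2 \<le> \<epsilon>" using h(1) by simp
  have r: "r \<ge> C / 2" using m3 \<epsilon>(3) C unfolding r_def by linarith
  show "m1\<^sup>2 + m2\<^sup>2 > 0" using r C(1) unfolding r_def by linarith
  have "(m2 * m3)\<^sup>2 \<le> C * \<epsilon>"
    unfolding power_mult_distrib using m3 C by (intro mult_mono) (auto intro: order_trans[OF _ eq_refl[OF C(2)]])
  then have "(m2 * m3)\<^sup>2 \<le> (1 / 2)\<^sup>2" using \<epsilon>(4) by (simp add: power2_eq_square)
  then have m23': "\<bar>m2 * m3\<bar> \<le> 1 / 2" using abs_le_square_iff[of "m2 * m3" "1/2"] by simp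
  then have B: "1 / 2 \<le> B" "B \<le> 3 / 2" unfolding B_def by linarith+
  have "\<xi> * B \<ge> 4" using low h(1) sq by linarith
  then have xi0: "\<xi> > 0" using B(1) zero_less_mult_pos2[of \<xi> B] by linarith
  have "4 \<le> \<xi> * (3 / 2)"
    using \<open>\<xi> * B \<ge> 4\<close> mult_left_mono[OF B(2), of \<xi>] xi0 by linarith
  then have xi2: "\<xi> \<ge> 2" by linarith
  have "\<xi> * (\<xi> * m3\<^sup>2) \<le> \<xi> * B" using low h(1) by (simp add: power2_eq_square mult.assoc)
  then have xm: "\<xi> * m3\<^sup>2 \<le> B" using xi0 by simp
  \<comment> \<open>Since \<xi> m3^2 lies between 0 and \<open>B\<close>, the bracket lies between
    -B and B.\<close>
  have "\<bar>B - 2 * \<xi> * m3\<^sup>2\<bar> \<le> 3 / 2"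
  proof -
    have "0 \<le> \<xi> * m3\<^sup>2" using xi0 by simp
    then show ?thesis using xm B unfolding mult.assoc by linarith
  qed
  moreover have s2: "0 \<le> s" "s \<le> 1 / 2"
    proof -
    have "1 / \<xi> \<le> 1 / 2" using xi2 by (intro divide_left_mono) auto
    then show "0 \<le> s" "s \<le> 1 / 2" using s(1)[OF xi0] s(2)[OF xi0] by linarith+
  qed
  ultimately have "\<bar>s * (B - 2 * \<xi> * m3\<^sup>2)\<bar> \<le> 1 / 2 * (3 / 2)"
    unfolding abs_mult by (intro mult_mono) auto
  then have term1: "s * (B - 2 * \<xi> * m3\<^sup>2) \<ge> - 3 / 4" by linarith
  \<comment> \<open>The momentum grows at most like the square root of \<xi>, so
    \<open>p * m1\<close> is bounded by a multiple of \<xi> plus a constant; the small factor m3^2/r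
    then tames it.\<close>
  have "(p - m1 / 2)\<^sup>2 \<le> \<xi> * B"
    using EB h(1) sq by linarith
  then have pm: "(p - m1 / 2)\<^sup>2 \<le> 3 / 2 * \<xi>" using mult_left_mono[OF B(2), of \<xi>] xi0 by linarith
  have m1: "m1\<^sup>2 \<le> C" using C(2) sq by linarith
  have "p\<^sup>2 \<le> 2 * (p - m1 / 2)\<^sup>2 + m1\<^sup>2 / 2"
    using zero_le_power2[of "p - m1"] by (simp add: power2_eq_square algebra_simps)
  moreover have "2 * \<bar>p * m1\<bar> \<le> p\<^sup>2 + m1\<^sup>2"
    using sum_squares_bound[of "\<bar>p\<bar>" "\<bar>m1\<bar>"] by (simp add: abs_mult)
  moreover have "\<bar>\<xi> * m2 * m3\<bar> \<le> \<xi> / 2"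
    using mult_left_mono[OF m23', of \<xi>] xi0 by (simp add: abs_mult mult.assoc)
  ultimately have pr: "\<bar>p * m1 + \<xi> * m2 * m3\<bar> \<le> 2 * \<xi> + 3 / 4 * C"
    using pm m1 by linarith
  have "m3\<^sup>2 / r \<le> \<epsilon> / (C / 2)"
    using m3 r C(1) \<epsilon>(1) by (intro frac_le) auto
  then have "\<bar>m3\<^sup>2 / r * (p * m1 + \<xi> * m2 * m3)\<bar> \<le> \<epsilon> / (C / 2) * (2 * \<xi> + 3 / 4 * C)"
    unfolding abs_mult using pr r C(1) \<epsilon>(1) by (intro mult_mono) auto
  also have "\<dots> = 4 * (\<epsilon> / C) * \<xi> + 3 / 2 * \<epsilon>" using C(1) by (simp add: field_simps)
  also have "\<dots> \<le> 4 * (1 / 16) * \<xi> + 1 / 4"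
    using \<epsilon>(2,3) C(1) xi0 by (intro add_mono mult_right_mono mult_left_mono) (auto simp: field_simps)
  finally have "- (4 * (1 / 16) * \<xi> + 1 / 4) \<le> m3\<^sup>2 / r * (p * m1 + \<xi> * m2 * m3)"
    by (simp only: abs_le_iff minus_le_iff)
  \<comment> \<open>The three terms add up to at least \<xi> - 3/4 - (\<xi>/4 + 1/4), which is
    positive because \<xi> \<ge> 2.\<close>
  then show "\<xi> + s * (1 + m2 * m3 - 2 * \<xi> * m3\<^sup>2) + m3\<^sup>2 / (m1\<^sup>2 + m2\<^sup>2) * (p * m1 + \<xi> * m2 * m3) > 0"
    using term1 xi2 unfolding B_def r_def by linarith
qed

section \<open>The Liouville form of the two-body problem\<close>

abbreviation (input) mcoord :: "phase \<Rightarrow> 3 \<Rightarrow> real" where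
  "mcoord x i \<equiv> snd (snd x) $ i"

definition strip :: "phase set" where
  "strip = {x. 0 < fst x \<and> fst x < pi}"

text \<open>The inner product of the sphere components alone. It expresses both the constraint |m|^2
  = C and, up to a factor 2, its differential.\<close>

definition mdot :: "phase \<Rightarrow> phase \<Rightarrow> real" where
  "mdot x v = mcoord x 1 * mcoord v 1 + mcoord x 2 * mcoord v 2 + mcoord x 3 * mcoord v 3"

definition ham_deriv :: "phase \<Rightarrow> phase \<Rightarrow> real" where
  "ham_deriv x v = (let \<xi> = cot (fst x); p = fst (snd x); m = mcoord x; u = mcoord v in
     (1 + \<xi>\<^sup>2) * (1 + m 2 * m 3 - 2 * \<xi> * (m 3)\<^sup>2) * fst v + (2 * p - m 1) * fst (snd v)
     + (m 1 - p) * u 1 + (m 2 - \<xi> * m 3) * u 2 + (2 * \<xi>\<^sup>2 * m 3 - \<xi> * m 2 + m 3) * u 3)"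

lemma bounded_linear_mcoord: "bounded_linear (\<lambda>x::phase. mcoord x i)"
  by (rule bounded_linear_compose[OF bounded_linear_vec_nth bounded_linear_compose[OF bounded_linear_snd bounded_linear_snd]])

lemma bounded_linear_momentum: "bounded_linear (\<lambda>x::phase. fst (snd x))"
  by (rule bounded_linear_compose[OF bounded_linear_fst bounded_linear_snd])

lemmas coord_derivs =
  bounded_linear_imp_has_derivative[OF bounded_linear_mcoord]
  bounded_linear_imp_has_derivative[OF bounded_linear_momentum]
  bounded_linear_imp_has_derivative[OF bounded_linear_fst]

lemma open_strip: "open strip"
proof -
  have "strip = fst -` {0<..<pi}" by (auto simp: strip_def)
  then show ?thesis by (metis open_vimage_fst open_greaterThanLessThan)
qed

lemma strip_sin: "x \<in> strip \<Longrightarrow> sin (fst x) \<noteq> 0"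
  using sin_gt_zero by (force simp: strip_def)

text \<open>The two halves of \<xi>^2 m3^2 combine, and powers become products, so that the sum and
  product rules for derivatives and smoothness apply directly.\<close>

lemma hamiltonian_alt: "hamiltonian = (\<lambda>x. ((mcoord x 1 * mcoord x 1 + mcoord x 2 * mcoord x 2 + mcoord x 3 * mcoord x 3) * (1/2)
    - mcoord x 1 * fst (snd x) + fst (snd x) * fst (snd x)
    - cot (fst x) * (1 + mcoord x 2 * mcoord x 3)
    + cot (fst x) * cot (fst x) * (mcoord x 3 * mcoord x 3)))"
  by (auto simp: fun_eq_iff hamiltonian_def Let_def power2_eq_square algebra_simps)

lemma hamiltonian_has_derivative:
  assumes "x \<in> strip"
  shows "(hamiltonian has_derivative ham_deriv x) (at x)"
proof -
  have s: "sin (fst x) \<noteq> 0" using strip_sin assms .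
  have "1 + (cot (fst x))\<^sup>2 = inverse ((sin (fst x))\<^sup>2)"
    using s sin_cos_squared_add[of "fst x"] by (simp add: cot_def field_simps)
  then have "DERIV cot (fst x) :> - (1 + (cot (fst x))\<^sup>2)"
    using DERIV_cot[OF s] by simp
  from DERIV_compose_FDERIV[OF this coord_derivs(3)]
  have c: "((\<lambda>x. cot (fst x)) has_derivative (\<lambda>v. fst v * - (1 + (cot (fst x))\<^sup>2))) (at x)" .
  show ?thesis
    unfolding hamiltonian_alt
    by (rule has_derivative_eq_rhs, (rule derivative_intros coord_derivs c)+)
      (simp add: fun_eq_iff ham_deriv_def Let_def power2_eq_square algebra_simps)
qed

lemma smooth_on_cot: "smooth_on strip (\<lambda>x. cot (fst x))"
proof -
  have sc: "smooth_on UNIV (sin :: real \<Rightarrow> real)" "smooth_on UNIV (cos :: real \<Rightarrow> real)"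
    using Ck_on_sin_cos by (auto simp: smooth_on_def)
  have f: "smooth_on strip (fst :: phase \<Rightarrow> real)"
    by (rule smooth_on_bounded_linear[OF open_strip bounded_linear_fst])
  have "smooth_on strip (\<lambda>x. cos (fst x) * inverse (sin (fst x)))"
    by (intro smooth_on_mult smooth_on_inverse open_strip strip_sin
        smooth_on_compose[OF open_strip open_UNIV sc(1) f] smooth_on_compose[OF open_strip open_UNIV sc(2) f]) auto
  then show ?thesis by (simp add: cot_def divide_inverse)
qed

lemmas smooth_on_coords = smooth_on_bounded_linear[OF _ bounded_linear_mcoord]
  smooth_on_bounded_linear[OF _ bounded_linear_momentum] smooth_on_bounded_linear[OF _ bounded_linear_fst]

lemma smooth_on_hamiltonian: "smooth_on strip hamiltonian"
  unfolding hamiltonian_alt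
  by (intro smooth_on_add smooth_on_diff smooth_on_mult smooth_on_const smooth_on_coords smooth_on_cot open_strip)

lemma mdot_has_derivative: "((\<lambda>x. mdot x x - C) has_derivative (\<lambda>v. 2 * mdot x v)) (at x)"
  unfolding mdot_def
  by (rule has_derivative_eq_rhs, (rule derivative_intros coord_derivs)+) (simp add: fun_eq_iff)

lemma smooth_on_mdot: "open S \<Longrightarrow> smooth_on S (\<lambda>x. mdot x x - C)"
  unfolding mdot_def by (intro smooth_on_add smooth_on_diff smooth_on_mult smooth_on_const smooth_on_coords)

section \<open>Phase space and energy levels as regular level sets\<close>

lemma phase_space_level_set: "phase_space C = {x \<in> strip. mdot x x - C = 0}"
  by (auto simp: phase_space_def strip_def mdot_def power2_eq_square)

lemma energy_level_set: "energy_level C h = {x \<in> strip. (mdot x x - C, hamiltonian x - h) = 0}"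
  unfolding energy_level_def phase_space_level_set by (auto simp: zero_prod_def)

text \<open>The normal direction of the sphere factor, used as a witness that the sphere constraint
  is regular.\<close>

definition radial :: "phase \<Rightarrow> phase" where
  "radial x = (0, 0, snd (snd x))"

lemma mdot_simps:
  "mdot x (radial x) = mdot x x" "mdot x (v + w) = mdot x v + mdot x w"
  "mdot x (c *\<^sub>R v) = c * mdot x v" "mdot x (v - w) = mdot x v - mdot x w"
  by (simp_all add: radial_def mdot_def algebra_simps)

lemma ham_deriv_simps:
  "ham_deriv x (v + w) = ham_deriv x v + ham_deriv x w"
  "ham_deriv x (c *\<^sub>R v) = c * ham_deriv x v"
  "ham_deriv x (v - w) = ham_deriv x v - ham_deriv x w"
  by (simp_all add: ham_deriv_def Let_def algebra_simps)

lemma surj_sphere_deriv: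
  assumes "C > 0" "x \<in> phase_space C"
  shows "surj (\<lambda>v. 2 * mdot x v)"
  using assms
  by (intro surjI[of _ "\<lambda>a. (a / (2 * C)) *\<^sub>R radial x"]) (simp add: mdot_simps phase_space_level_set)

lemma tangent_phase_space:
  assumes "C > 0" "x \<in> phase_space C"
  shows "tangent_space (phase_space C) x = {v. mdot x v = 0}"
proof (intro equalityI subsetI CollectI)
  fix v assume "v \<in> tangent_space (phase_space C) x"
  from tangent_space_subset_kernel[OF this mdot_has_derivative[of C]] show "mdot x v = 0"
    by (simp add: phase_space_level_set)
next
  fix v assume "v \<in> {v. mdot x v = 0}"
  then show "v \<in> tangent_space (phase_space C) x"
    using assms
    by (intro kernel_subset_tangent_space[OF open_strip smooth_on_mdot[OF open_strip] phase_space_level_set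
          mdot_has_derivative surj_sphere_deriv]) auto
qed

lemma phase_space_submanifold:
  assumes "C > 0"
  shows "smooth_submanifold 4 (phase_space C)"
proof (rule regular_level_submanifold[OF open_strip smooth_on_mdot[OF open_strip] phase_space_level_set])
  fix x assume "x \<in> phase_space C"
  then show "surj (frechet_derivative (\<lambda>x. mdot x x - C) (at x))"
    using surj_sphere_deriv[OF assms] frechet_derivative_at[OF mdot_has_derivative] by metis
qed simp

lemma energy_level_has_derivative:
  assumes "x \<in> strip"
  shows "((\<lambda>x. (mdot x x - C, hamiltonian x - h)) has_derivative (\<lambda>v. (2 * mdot x v, ham_deriv x v))) (at x)"
  using has_derivative_Pair[OF mdot_has_derivative
      has_derivative_diff[OF hamiltonian_has_derivative[OF assms] has_derivative_const]] by simp

text \<open>A triangular system: \<open>radial x\<close> attains the sphere component, and a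
  multiple of \<open>Y\<close>, which leaves that component alone, corrects the energy
  component.\<close>

lemma surj_energy_deriv:
  assumes "C > 0" "x \<in> phase_space C" and Y: "mdot x Y = 0" "ham_deriv x Y \<noteq> 0"
  shows "surj (\<lambda>v. (2 * mdot x v, ham_deriv x v))"
proof (rule surjI)
  fix ab :: "real \<times> real"
  obtain a b where ab: "ab = (a, b)" by (cases ab)
  let ?f = "\<lambda>ab. (fst ab / (2 * C)) *\<^sub>R radial x
      + ((snd ab - ham_deriv x ((fst ab / (2 * C)) *\<^sub>R radial x)) / ham_deriv x Y) *\<^sub>R Y"
  show "(2 * mdot x (?f ab), ham_deriv x (?f ab)) = ab"
    using assms unfolding ab fst_conv snd_conv
    by (simp add: mdot_simps(1-3) ham_deriv_simps(1,2) phase_space_level_set)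
qed

section \<open>The Liouville form and field\<close>

abbreviation (input) equatorial :: "phase \<Rightarrow> real" where
  "equatorial x \<equiv> mcoord x 1 * mcoord x 1 + mcoord x 2 * mcoord x 2"

definition liouville_form :: "real \<Rightarrow> phase \<Rightarrow> phase \<Rightarrow> real" where
  "liouville_form C x v = - fst x * fst (snd v)
     + C * (mcoord x 3 * (mcoord x 2 * mcoord v 1 - mcoord x 1 * mcoord v 2)) * inverse (equatorial x)"

text \<open>The component \<open>m3\<close> along the axis changes |m|^2 at rate 2 m3^2; the factor
  \<open>k\<close> shrinks (m1, m2) radially, so with \<phi> fixed, just enough to
  compensate.\<close>

definition liouville_field :: "phase \<Rightarrow> phase" where
  "liouville_field x = (let k = (mcoord x 3)\<^sup>2 / equatorial x in
     (fst x, 0, vector [- k * mcoord x 1, - k * mcoord x 2, mcoord x 3]))"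

lemma liouville_field_mdot:
  assumes "equatorial x \<noteq> 0"
  shows "mdot x (liouville_field x) = 0"
proof -
  define k where "k = (mcoord x 3)\<^sup>2 / equatorial x"
  have "k * equatorial x = (mcoord x 3)\<^sup>2" by (rule nonzero_eq_divide_eq[THEN iffD1, OF assms k_def])
  then have "mcoord x 1 * (- k * mcoord x 1) + mcoord x 2 * (- k * mcoord x 2) + mcoord x 3 * mcoord x 3 = 0"
    by algebra
  then show ?thesis by (simp add: mdot_def liouville_field_def k_def[symmetric])
qed

text \<open>On the sphere C = r + m3^2 with r = m1^2 + m2^2, hence C/r = 1 + k. The 1 comes from the
  axial and the \<open>k\<close> from the equatorial components of the field.\<close>

lemma liouville_field_form:
  assumes "mdot x x = C" "equatorial x \<noteq> 0"
  shows "omega x (liouville_field x) v = liouville_form C x v"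
proof -
  define k where "k = (mcoord x 3)\<^sup>2 / equatorial x"
  have "C = equatorial x + (mcoord x 3)\<^sup>2" using assms(1) by (simp add: mdot_def power2_eq_square)
  then have k: "C * inverse (equatorial x) = 1 + k"
    using right_inverse[OF assms(2)] by (simp only: k_def distrib_right divide_inverse)
  have "liouville_form C x v = - fst x * fst (snd v)
      + C * inverse (equatorial x) * (mcoord x 3 * (mcoord x 2 * mcoord v 1 - mcoord x 1 * mcoord v 2))"
    by (simp only: liouville_form_def ac_simps)
  also have "\<dots> = omega x (liouville_field x) v"
    unfolding k by (simp add: omega_def split_beta liouville_field_def k_def[symmetric] algebra_simps)
  finally show ?thesis ..
qed

section \<open>The symplectic form on the phase space\<close>

lemma omega_skew: "omega x v w = - omega x w v"
  by (simp add: omega_def split_beta algebra_simps)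

lemma omega_linear:
  "omega x v (c *\<^sub>R w) = c * omega x v w"
  "omega x v (w - w') = omega x v w - omega x v w'"
  by (simp_all add: omega_def split_beta algebra_simps)

text \<open>The unit vectors in \<open>q\<close> and \<open>p\<close> detect the first two
  components of \<open>v\<close>. On the sphere the form is the triple product m . (u x w); testing
  with w = m x u, which is tangent, gives |m x u|^2 = 0. As u is also orthogonal to m, it
  vanishes.\<close>

lemma omega_nondegenerate:
  assumes "C > 0" "mdot x x = C" "mdot x v = 0" and z: "\<And>w. mdot x w = 0 \<Longrightarrow> omega x v w = 0"
  shows "v = 0"
proof -
  obtain q p m a b u where x: "x = (q, p, m)" "v = (a, b, u)" by (cases x, cases v) auto
  have b: "b = 0" using z[of "(1, 0, 0)"] by (simp add: x omega_def mdot_def)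
  have a: "a = 0" using z[of "(0, 1, 0)"] by (simp add: x omega_def mdot_def)
  define c where "c = (vector [m$2 * u$3 - m$3 * u$2, m$3 * u$1 - m$1 * u$3, m$1 * u$2 - m$2 * u$1] :: real^3)"
  have c: "c$1 = m$2 * u$3 - m$3 * u$2" "c$2 = m$3 * u$1 - m$1 * u$3" "c$3 = m$1 * u$2 - m$2 * u$1"
    by (simp_all add: c_def)
  have "mdot x (0, 0, c) = 0" by (simp add: x mdot_def c algebra_simps)
  then have "omega x v (0, 0, c) = 0" by (rule z)
  moreover have "omega x v (0, 0, c) = (c$1)\<^sup>2 + (c$2)\<^sup>2 + (c$3)\<^sup>2"
    unfolding c by (simp add: x omega_def c power2_eq_square algebra_simps)
  ultimately have "(c$1)\<^sup>2 + (c$2)\<^sup>2 + (c$3)\<^sup>2 = 0" by simp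
  then have c0: "c$1 = 0" "c$2 = 0" "c$3 = 0"
    by (simp_all add: add_nonneg_eq_0_iff)
  have mu: "m$1 * u$1 + m$2 * u$2 + m$3 * u$3 = 0" and mm: "m$1 * m$1 + m$2 * m$2 + m$3 * m$3 = C"
    using assms(2,3) by (simp_all add: x mdot_def)
  have "C * u$1 = 0" "C * u$2 = 0" "C * u$3 = 0"
    \<comment> \<open>This is |m|^2 u = (m . u) m - m x (m x u), where both terms on the right
      vanish.\<close>
    using c0 mu unfolding c mm[symmetric] by algebra+
  then have "u$1 = 0" "u$2 = 0" "u$3 = 0" using assms(1) by simp_all
  then have "u = 0" by (simp add: vec_eq_iff forall_3)
  then show ?thesis using a b x by (simp add: zero_prod_def)
qed

lemma omega_open_form2: "open_form2 UNIV omega"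
proof -
  have "smooth_on UNIV (\<lambda>x. omega x u v)" for u v
    unfolding omega_def split_beta
    by (intro smooth_on_add smooth_on_mult smooth_on_const smooth_on_coords open_UNIV)
  moreover have "bilinear (omega x)" "omega x v v = 0" for x v
    by (auto simp: bilinear_def omega_def split_beta algebra_simps intro!: linearI)
  ultimately show ?thesis by (simp add: open_form2_def)
qed

text \<open>In the ambient space the form is not closed: its derivative is three times the volume
  form dm1 dm2 dm3. Only the restriction to the sphere is closed.\<close>

lemma omega_ext_deriv2:
  "ext_deriv2 omega x u v w =
     3 * (mcoord u 1 * (mcoord v 2 * mcoord w 3 - mcoord w 2 * mcoord v 3)
        + mcoord u 2 * (mcoord v 3 * mcoord w 1 - mcoord w 3 * mcoord v 1)
        + mcoord u 3 * (mcoord v 1 * mcoord w 2 - mcoord w 1 * mcoord v 2))"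
proof -
  have "((\<lambda>y. omega y v w) has_derivative
     (\<lambda>u. mcoord u 1 * (mcoord v 2 * mcoord w 3 - mcoord w 2 * mcoord v 3)
        + mcoord u 2 * (mcoord v 3 * mcoord w 1 - mcoord w 3 * mcoord v 1)
        + mcoord u 3 * (mcoord v 1 * mcoord w 2 - mcoord w 1 * mcoord v 2))) (at x)" for v w
    unfolding omega_def split_beta
    by (rule has_derivative_eq_rhs, (rule derivative_intros coord_derivs)+) simp
  from frechet_derivative_at[OF this, symmetric]
  show ?thesis by (simp add: ext_deriv2_def algebra_simps)
qed

lemma ext_deriv2_omega_tangent:
  assumes "C > 0" "mdot x x = C" "mdot x u = 0" "mdot x v = 0" "mdot x w = 0"
  shows "ext_deriv2 omega x u v w = 0"
proof -
  let ?D = "mcoord u 1 * (mcoord v 2 * mcoord w 3 - mcoord w 2 * mcoord v 3)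
        + mcoord u 2 * (mcoord v 3 * mcoord w 1 - mcoord w 3 * mcoord v 1)
        + mcoord u 3 * (mcoord v 1 * mcoord w 2 - mcoord w 1 * mcoord v 2)"
  \<comment> \<open>Cramer's rule: m solves the homogeneous system whose rows are the sphere
    components of \<open>u\<close>, \<open>v\<close>, \<open>w\<close>, so the determinant times
    each coordinate of m is zero.\<close>
  have "mcoord x 1 * ?D = 0" "mcoord x 2 * ?D = 0" "mcoord x 3 * ?D = 0"
    using assms(3-5) unfolding mdot_def by algebra+
  then have "(mcoord x 1 * mcoord x 1 + mcoord x 2 * mcoord x 2 + mcoord x 3 * mcoord x 3) * ?D = 0"
    by (simp only: distrib_right mult.assoc mult_zero_right add_0_left)
  then have "?D = 0" using assms(1,2) by (simp add: mdot_def)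
  then show ?thesis unfolding omega_ext_deriv2 by simp
qed

lemma phase_space_symplectic:
  assumes "C > 0"
  shows "symplectic_manifold 4 (phase_space C) omega"
  unfolding symplectic_manifold_def
proof (intro conjI ballI)
  show "smooth_submanifold 4 (phase_space C)" by (rule phase_space_submanifold[OF assms])
  have ext: "extends2 (phase_space C) omega UNIV omega"
    by (simp add: extends2_def omega_open_form2)
  then show "form2_on (phase_space C) omega" unfolding form2_on_def by blast
  have "ext_deriv2 omega x u v w = 0"
    if "x \<in> phase_space C" "u \<in> tangent_space (phase_space C) x"
      "v \<in> tangent_space (phase_space C) x" "w \<in> tangent_space (phase_space C) x" for x u v w
      proof -
    have "mdot x x = C" using that(1) by (simp add: phase_space_level_set)
    then show ?thesis
      using that(2-4) ext_deriv2_omega_tangent[OF assms] unfolding tangent_phase_space[OF assms that(1)] by simp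
  qed
  then show "closed_form2_on (phase_space C) omega"
    unfolding closed_form2_on_def using ext by blast
  fix x assume x: "x \<in> phase_space C"
  have "mdot x x = C" using x by (simp add: phase_space_level_set)
  then show "form_kernel (phase_space C) omega x = {0}"
    using omega_nondegenerate[OF assms] unfolding form_kernel_def tangent_phase_space[OF assms x]
    by (auto simp: mdot_def omega_def split_beta)
qed

section \<open>The Liouville form as a primitive of the symplectic form\<close>

lemma open_nonpolar: "open {x. equatorial x \<noteq> 0}"
  by (intro open_Collect_neq continuous_intros linear_continuous_on bounded_linear_mcoord)

lemma liouville_open_form1: "open_form1 {x. equatorial x \<noteq> 0} (liouville_form C)"
proof -
  have "smooth_on {x. equatorial x \<noteq> 0} (\<lambda>x. (-1) * fst x * fst (snd v)
     + C * (mcoord x 3 * (mcoord x 2 * mcoord v 1 - mcoord x 1 * mcoord v 2)) * inverse (equatorial x))" for v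
    by (intro smooth_on_add smooth_on_diff smooth_on_mult smooth_on_inverse smooth_on_const smooth_on_coords open_nonpolar) simp
  then have "smooth_on {x. equatorial x \<noteq> 0} (\<lambda>x. liouville_form C x v)" for v
    by (simp add: liouville_form_def)
  moreover have "linear (liouville_form C x)" for x
    by (intro linearI) (simp_all add: liouville_form_def algebra_simps)
  ultimately show ?thesis using open_nonpolar by (simp add: open_form1_def)
qed

text \<open>Off the poles d\<phi> is closed, so only dp dq - C dm3 d\<phi> survives; on tangent
  vectors of the sphere the last term is the area form appearing in \<open>omega\<close>.\<close>

lemma liouville_ext_deriv1:
  assumes "mdot x x = C" "equatorial x \<noteq> 0" "mdot x u = 0" "mdot x v = 0"
  shows "ext_deriv1 (liouville_form C) x u v = omega x u v"
proof -
  let ?N = "\<lambda>v. mcoord x 2 * mcoord v 1 - mcoord x 1 * mcoord v 2"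
  define r where "r = equatorial x"
  have r: "r \<noteq> 0" using assms by (simp add: r_def)
  have "((\<lambda>y. equatorial y) has_derivative (\<lambda>u. 2 * (mcoord x 1 * mcoord u 1 + mcoord x 2 * mcoord u 2))) (at x)"
    by (rule has_derivative_eq_rhs, (rule derivative_intros coord_derivs)+) (simp add: fun_eq_iff)
  from Deriv.has_derivative_inverse[of equatorial, OF assms(2) this]
  have inv: "((\<lambda>y. inverse (equatorial y)) has_derivative
      (\<lambda>u. - (inverse r * (2 * (mcoord x 1 * mcoord u 1 + mcoord x 2 * mcoord u 2)) * inverse r))) (at x)"
    by (simp only: r_def)
  have "((\<lambda>y. liouville_form C y v) has_derivative
     (\<lambda>u. - fst u * fst (snd v) + C * ((mcoord u 3 * ?N v + mcoord x 3 * (mcoord u 2 * mcoord v 1 - mcoord u 1 * mcoord v 2)) * inverse r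
         - mcoord x 3 * ?N v * (2 * (mcoord x 1 * mcoord u 1 + mcoord x 2 * mcoord u 2)) * inverse r * inverse r))) (at x)" for v
    unfolding liouville_form_def
    by (rule has_derivative_eq_rhs,
        (rule inv derivative_intros coord_derivs)+)
      (simp add: fun_eq_iff r_def[symmetric] algebra_simps)
  from frechet_derivative_at[OF this, symmetric]
  have 1: "ext_deriv1 (liouville_form C) x u v = - fst u * fst (snd v) + fst v * fst (snd u)
      + C * ((mcoord u 3 * ?N v - mcoord v 3 * ?N u + 2 * mcoord x 3 * (mcoord u 2 * mcoord v 1 - mcoord u 1 * mcoord v 2)) * inverse r
         - 2 * mcoord x 3 * (?N v * (mcoord x 1 * mcoord u 1 + mcoord x 2 * mcoord u 2)
           - ?N u * (mcoord x 1 * mcoord v 1 + mcoord x 2 * mcoord v 2)) * inverse r * inverse r)"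
    by (simp add: ext_deriv1_def algebra_simps)
  have "?N v * (mcoord x 1 * mcoord u 1 + mcoord x 2 * mcoord u 2)
           - ?N u * (mcoord x 1 * mcoord v 1 + mcoord x 2 * mcoord v 2)
       = (mcoord u 2 * mcoord v 1 - mcoord u 1 * mcoord v 2) * r"
    by (simp add: r_def algebra_simps)
  note N = this
  define i where "i = inverse r"
  have ri: "r * i = 1" using r by (simp add: i_def)
  \<comment> \<open>The terms with an undifferentiated \<open>mcoord x 3\<close> cancel; this is the
    closedness of d\<phi>.\<close>
  have 2: "ext_deriv1 (liouville_form C) x u v = - fst u * fst (snd v) + fst v * fst (snd u)
      + C * (mcoord u 3 * ?N v - mcoord v 3 * ?N u) * inverse r"
    unfolding 1 N i_def[symmetric] using ri by algebra
  define c1 c2 c3 where c: "c1 = mcoord u 2 * mcoord v 3 - mcoord v 2 * mcoord u 3"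
    "c2 = mcoord u 3 * mcoord v 1 - mcoord v 3 * mcoord u 1"
    "c3 = mcoord u 1 * mcoord v 2 - mcoord v 1 * mcoord u 2"
  \<comment> \<open>(c1, c2, c3) is the cross product of two tangent vectors, hence parallel to
    m.\<close>
  have par: "mcoord x 3 * c1 = mcoord x 1 * c3" "mcoord x 3 * c2 = mcoord x 2 * c3"
    using assms(3,4) unfolding c mdot_def by algebra+
  have "C = r + mcoord x 3 * mcoord x 3" using assms(1) by (simp add: mdot_def r_def)
  then have "C * (mcoord x 1 * c1 + mcoord x 2 * c2)
     = r * (mcoord x 1 * c1 + mcoord x 2 * c2 + mcoord x 3 * c3)"
    using par unfolding r_def by algebra
  moreover have "mcoord u 3 * ?N v - mcoord v 3 * ?N u = mcoord x 1 * c1 + mcoord x 2 * c2"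
    by (simp add: c algebra_simps)
  ultimately have "C * (mcoord u 3 * ?N v - mcoord v 3 * ?N u) * inverse r
     = mcoord x 1 * c1 + mcoord x 2 * c2 + mcoord x 3 * c3"
    using r by simp
  then show ?thesis unfolding 2 by (simp add: omega_def split_beta c algebra_simps)
qed

section \<open>Transversality at low energy\<close>

text \<open>Writing q (1 + \<xi>^2) as \<xi> plus the cotangent defect exposes the cancellations:
  the terms 2 \<xi>^2 m3^2 and \<xi> m2 m3 drop out, and so does m3^2 against k (m1^2 + m2^2). What
  remains has the shape treated in \<open>energy_estimate\<close>.\<close>

lemma ham_deriv_liouville:
  assumes "equatorial x \<noteq> 0"
  defines "\<xi> \<equiv> cot (fst x)"
  shows "ham_deriv x (liouville_field x) = \<xi>
    + (fst x * (1 + \<xi>\<^sup>2) - \<xi>) * (1 + mcoord x 2 * mcoord x 3 - 2 * \<xi> * (mcoord x 3)\<^sup>2)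
    + (mcoord x 3)\<^sup>2 / equatorial x * (fst (snd x) * mcoord x 1 + \<xi> * mcoord x 2 * mcoord x 3)"
proof -
  define k where "k = (mcoord x 3)\<^sup>2 / equatorial x"
  have "k * equatorial x = (mcoord x 3)\<^sup>2" by (rule nonzero_eq_divide_eq[THEN iffD1, OF assms(1) k_def])
  moreover have "ham_deriv x (liouville_field x) =
      (1 + \<xi>\<^sup>2) * (1 + mcoord x 2 * mcoord x 3 - 2 * \<xi> * (mcoord x 3)\<^sup>2) * fst x
      + (mcoord x 1 - fst (snd x)) * (- k * mcoord x 1) + (mcoord x 2 - \<xi> * mcoord x 3) * (- k * mcoord x 2)
      + (2 * \<xi>\<^sup>2 * mcoord x 3 - \<xi> * mcoord x 2 + mcoord x 3) * mcoord x 3"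
    by (simp add: ham_deriv_def liouville_field_def Let_def \<xi>_def k_def[symmetric])
  ultimately show ?thesis
    unfolding k_def[symmetric] by algebra
qed

lemma liouville_transverse:
  assumes "C > 0"
  obtains h0 where "\<And>h x. h < h0 \<Longrightarrow> x \<in> energy_level C h \<Longrightarrow>
    equatorial x \<noteq> 0 \<and> ham_deriv x (liouville_field x) > 0"
proof -
  define \<epsilon> where "\<epsilon> = min (1/6) (min (C / 16) (1 / (4 * C)))"
  have \<epsilon>: "\<epsilon> > 0" "\<epsilon> \<le> 1/6" "\<epsilon> \<le> C / 16" "\<epsilon> \<le> 1 / (4 * C)"
    unfolding \<epsilon>_def using assms by auto
  have \<epsilon>4: "4 * C * \<epsilon> \<le> 1" using \<epsilon>(4) assms by (simp add: field_simps)
  show thesis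
  \<comment> \<open>The first bound will give \<xi> B \<ge> 4 in the estimate, the second m3^2 \<le>
    \<epsilon>.\<close>
  proof (rule that[of "min (-4) (- ((1 + C)\<^sup>2 / (4 * \<epsilon>)))"])
    fix h x assume h: "h < min (-4) (- ((1 + C)\<^sup>2 / (4 * \<epsilon>)))" and x: "x \<in> energy_level C h"
    let ?\<xi> = "cot (fst x)"
    have h4: "h \<le> - 4" using h by simp
    have "(1 + C)\<^sup>2 / (4 * \<epsilon>) \<le> - h" using h by simp
    then have hC: "(1 + C)\<^sup>2 \<le> 4 * \<epsilon> * (- h)" using \<epsilon>(1) by (simp add: field_simps)
    have x': "x \<in> strip" "mdot x x = C" "hamiltonian x = h"
      using x by (auto simp: energy_level_set zero_prod_def)
    have C: "(mcoord x 1)\<^sup>2 + (mcoord x 2)\<^sup>2 + (mcoord x 3)\<^sup>2 = C"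
      using x'(2) by (simp add: mdot_def power2_eq_square)
    have E: "(fst (snd x))\<^sup>2 - mcoord x 1 * fst (snd x) + ((mcoord x 1)\<^sup>2 + (mcoord x 2)\<^sup>2 + (mcoord x 3)\<^sup>2) / 2
        - ?\<xi> * (1 + mcoord x 2 * mcoord x 3) + ?\<xi>\<^sup>2 * (mcoord x 3)\<^sup>2 = h"
      using x'(3) by (simp add: hamiltonian_alt power2_eq_square)
    have s: "?\<xi> > 0 \<Longrightarrow> 0 \<le> fst x * (1 + ?\<xi>\<^sup>2) - ?\<xi>"
        "?\<xi> > 0 \<Longrightarrow> fst x * (1 + ?\<xi>\<^sup>2) - ?\<xi> \<le> 1 / ?\<xi>"
      using x'(1) cot_defect_bounds[of "fst x"] by (auto simp: strip_def)
    note est = energy_estimate[OF assms C \<epsilon>(1-3) \<epsilon>4 h4 hC E s]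
    have eq: "equatorial x \<noteq> 0" using est(1) unfolding power2_eq_square by linarith
    moreover have "ham_deriv x (liouville_field x) > 0"
      unfolding ham_deriv_liouville[OF eq] using est(2) by (simp add: power2_eq_square)
    ultimately show "equatorial x \<noteq> 0 \<and> ham_deriv x (liouville_field x) > 0" ..
  qed
qed

theorem theorem4p5:
  fixes C :: real
  assumes "C > 0"
  shows "\<exists>h\<^sub>0::real. \<forall>h<h\<^sub>0. contact_type_hypersurface (phase_space C) omega (energy_level C h)"
proof -
  obtain h0 where h0: "\<And>h x. h < h0 \<Longrightarrow> x \<in> energy_level C h \<Longrightarrow>
      equatorial x \<noteq> 0 \<and> ham_deriv x (liouville_field x) > 0"
    using liouville_transverse[OF assms] by blast
  have "contact_type_hypersurface (phase_space C) omega (energy_level C h)" if h: "h < h0" for h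
  proof -
    let ?X = "energy_level C h" and ?M = "phase_space C"
    have sub: "?X \<subseteq> ?M" by (auto simp: energy_level_def)
    have smooth: "smooth_on strip (\<lambda>x. (mdot x x - C, hamiltonian x - h))"
      by (intro smooth_on_Pair smooth_on_mdot smooth_on_diff smooth_on_hamiltonian smooth_on_const open_strip)
    have X: "x \<in> strip" "x \<in> ?M" "mdot x x = C" "equatorial x \<noteq> 0" "ham_deriv x (liouville_field x) \<noteq> 0"
        "mdot x (liouville_field x) = 0" if "x \<in> ?X" for x
      using that h0[OF h that] sub liouville_field_mdot by (auto simp: phase_space_level_set)
    \<comment> \<open>The Liouville field is tangent to the phase space and changes the energy, so
      the energy level is regular.\<close>
    have surj: "surj (\<lambda>v. (2 * mdot x v, ham_deriv x v))" if "x \<in> ?X" for x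
      using surj_energy_deriv[OF assms X(2)[OF that] X(6)[OF that] X(5)[OF that]] .
    have "smooth_submanifold 3 ?X"
    proof (rule regular_level_submanifold[OF open_strip smooth energy_level_set])
      fix x assume x: "x \<in> ?X"
      show "surj (frechet_derivative (\<lambda>x. (mdot x x - C, hamiltonian x - h)) (at x))"
        using surj[OF x] by (simp only: frechet_derivative_at[OF energy_level_has_derivative[OF X(1)[OF x]], symmetric])
    qed simp
    moreover have tangent: "mdot x v = 0" if "x \<in> ?X" "v \<in> tangent_space ?X x" for x v
      using that tangent_space_mono[OF sub] tangent_phase_space[OF assms X(2)] by blast
    have ext: "extends1 ?X (liouville_form C) {x. equatorial x \<noteq> 0} (liouville_form C)"
      unfolding extends1_def using liouville_open_form1 by blast
    have "form1_on ?X (liouville_form C)"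
      unfolding form1_on_def
    proof (intro ballI exI conjI)
      fix x assume "x \<in> ?X"
      then show "x \<in> {x. equatorial x \<noteq> 0}" using X(4) by blast
    qed (rule ext)
    moreover have "has_ext_deriv1 ?X (liouville_form C) omega"
      unfolding has_ext_deriv1_def
    proof (intro ballI exI conjI)
      fix x assume x: "x \<in> ?X"
      then show "x \<in> {x. equatorial x \<noteq> 0}" using X(4) by blast
      fix u v assume "u \<in> tangent_space ?X x" "v \<in> tangent_space ?X x"
      then show "ext_deriv1 (liouville_form C) x u v = omega x u v"
        using liouville_ext_deriv1[OF X(3,4)[OF x]] tangent[OF x] by simp
    qed (rule ext)
    moreover have "liouville_form C x v \<noteq> 0" if x: "x \<in> ?X" and v: "v \<in> form_kernel ?X omega x" "v \<noteq> 0" for x v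
    proof
      assume z: "liouville_form C x v = 0"
      let ?Y = "liouville_field x"
      have vT: "mdot x v = 0" and vk: "\<And>w. w \<in> tangent_space ?X x \<Longrightarrow> omega x v w = 0"
        using v(1) tangent[OF x] by (auto simp: form_kernel_def)
      \<comment> \<open>Contracting \<open>omega\<close> with the field gives the form, so a zero of
        the form on \<open>v\<close> means that \<open>v\<close> is orthogonal to the field.\<close>
      have vY: "omega x v ?Y = 0"
        using liouville_field_form[OF X(3)[OF x] X(4)[OF x], of v] z omega_skew[of x v ?Y] by simp
      have "omega x v w = 0" if w: "mdot x w = 0" for w
      proof -
        \<comment> \<open>Subtracting this multiple of the field removes the energy component of
          \<open>w\<close>; the difference is tangent to the energy level, so \<open>v\<close> is
          orthogonal to it and to the field, hence to \<open>w\<close>.\<close>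
        let ?c = "ham_deriv x w / ham_deriv x ?Y"
        have "w - ?c *\<^sub>R ?Y \<in> tangent_space ?X x"
          by (rule kernel_subset_tangent_space[OF open_strip smooth energy_level_set
                energy_level_has_derivative[OF X(1)[OF x]] surj[OF x] x])
            (use X(5,6)[OF x] w in \<open>simp add: mdot_simps ham_deriv_simps zero_prod_def\<close>)
        from vk[OF this] show ?thesis by (simp add: omega_linear vY)
      qed
      then have "v = 0" by (rule omega_nondegenerate[OF assms X(3)[OF x] vT])
      then show False using v(2) by simp
    qed
    ultimately show ?thesis
      unfolding contact_type_hypersurface_def
      using phase_space_symplectic[OF assms] sub
      by (intro conjI exI[of _ 3] exI[of _ "liouville_form C"]) auto
  qed
  then show ?thesis by blast
qed

end
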